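(* Let $\rho>0$, $V\in\bar{\mathcal{V}}^{4}_{\delta_4}$ for some integer $1/\delta_4\in[4,+\infty)$, and let $w:\mathbb{R}^d\to[0,\infty)$ be continuous with $$\mathcal{L}V^{\rho}(x)\le -w(x)\qquad\forall x\in\mathbb{R}^d .$$ Assume that $V(\epsilon x)\le V(x)$ for all $x\in\mathbb{R}^d$, $0<\epsilon\le1$, and that $$\sup_{0<|x|\le u}\frac{|f(x)|^2\vee|g(x)|^2}{\Lambda_\rho(x)V^{2\delta_4}(x)}<+\infty\qquad\forall u>0,\qquad \Lambda_\rho(x):=1\wedge\frac{w(x)}{V^\rho(x)} .$$ Then there is a constant $\Delta^{**}\in(0,\Delta^*]$ such that for any $\Delta\in(0,\Delta^{**}]$ the truncated Euler--Maruyama scheme $\{Z_k\}$ defined in the context satisfies $$\limsup_{k\to\infty}V^{\rho}(Z_k)<\infty,\qquad \lim_{k\to\infty}d\big(Z_k,\mathrm{Ker}(w)\big)=0\qquad\text{a.s.}$$ Moreover, if $w(x)=0$ if and only if $x=\mathbf{0}\in\mathbb{R}^d$, then for any $\Delta\in(0,\Delta^{**}]$, $\lim_{k\to\infty}Z_k=\mathbf{0}$ a.s.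
   Context: **SDE.** $|\cdot|$ is the Euclidean norm on $\mathbb{R}^d$ and the trace (Frobenius) norm on matrices; $\mathbb{R}_+=(0,\infty)$, $\bar{\mathbb{R}}_+=[0,\infty)$; $a\vee b=\max\{a,b\}$, $a\wedge b=\min\{a,b\}$. On a complete filtered probability space $(\Omega,\mathcal{F},\{\mathcal{F}_t\}_{t\ge0},\mathbb{P})$ satisfying the usual conditions, $B(t)$ is an $m$-dimensional $\mathcal{F}_t$-Brownian motion. Consider $\mathrm{d}X(t)=f(X(t))\mathrm{d}t+g(X(t))\mathrm{d}B(t)$, $X(0)=x_0\in\mathbb{R}^d$, where $f:\mathbb{R}^d\to\mathbb{R}^d$, $g:\mathbb{R}^d\to\mathbb{R}^{d\times m}$ are locally Lipschitz continuous with $f(\mathbf{0})=\mathbf{0}$ and $g(\mathbf{0})=\mathbf{0}$. **Lyapunov functions.** $\mathcal{C}^p_\infty(\mathbb{R}^d;\bar{\mathbb{R}}_+)$ is the set of nonnegative $p$-times continuously differentiable functions on $\mathbb{R}^d$ tending to $\infty$ as $|x|\to\infty$. For a multiindex $\alpha$, $D^\alpha V$ is the usual partial derivative; $|D^{(n)}V(x)|=\big(\sum_{|\alpha|=n}|D^\alpha V(x)|^2\big)^{1/2}$; $D^{(1)}V$ is the gradient (row vector), $D^{(2)}V$ the Hessian (Frobenius norm). $\mathrm{Ker}(h)=\{x\in\mathbb{R}^d:h(x)=0\}$, and $d(x,A)$ is the distance from $x$ to the set $A$. For integers $p\ge2$ and $1/\delta_p\ge p$, $$\bar{\mathcal{V}}^{p}_{\delta_p}=\{V\in\mathcal{C}^p_\infty(\mathbb{R}^d;\bar{\mathbb{R}}_+):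 \mathrm{Ker}(V)=\{\mathbf{0}\},\ \exists c>0,\ |D^{(n)}V|\le cV^{1-n\delta_p},\ n=1,\dots,p\}.$$ $\mathcal{L}V(x)=\langle D^{(1)}V(x),f(x)\rangle+\frac12\mathrm{tr}[g^T(x)D^{(2)}V(x)g(x)]$, and $\mathcal{L}V^\rho(x)=\frac{\rho}{2}V^{\rho-2}(x)\big[2V(x)\mathcal{L}V(x)+(\rho-1)|D^{(1)}V(x)g(x)|^2\big]$ (read as $0$ at $x=\mathbf{0}$, where $f$ and $g$ vanish). In quotients with denominator containing $\Lambda_\rho(x)=0$, $0/0$ is read as $0$ and $a/0$ as $+\infty$ for $a>0$. **Scheme.** Choose a strictly increasing continuous $\bar\varphi:\mathbb{R}_+\to\mathbb{R}_+$ with $\bar\varphi(u)\to\infty$ as $u\to\infty$ and $$\sup_{0<|x|\le u}\left[\frac{|f(x)|}{\Lambda_\rho^{1/2}(x)V^{\delta_4}(x)}\vee\frac{|g(x)|^2}{\Lambda_\rho(x)V^{2\delta_4}(x)}\right]\le\bar\varphi(u)\qquad\forall u\ge1,$$ with inverse $\bar\varphi^{-1}:[\bar\varphi(1),\infty)\to\mathbb{R}_+$. Choose $0<\bar\theta<1/2$ and constants $\Delta^*\in(0,1)$, $K>0$ with $K(\Delta^* )^{-\bar\theta}\ge\bar\varphi(|x_0|\vee1)$ ($K$ independent of $\Delta$). For $\Delta\in(0,\Delta^*]$ put $\bar\pi_\Delta(x)=\big(|x|\wedge\bar\varphi^{-1}(K\Delta^{-\bar\theta})\big)\frac{x}{|x|}$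 (with $x/|x|=\mathbf{0}$ for $x=\mathbf{0}$), $t_k=k\Delta$, $\Delta B_k=B(t_{k+1})-B(t_k)$, and for integers $k\ge0$ $$Z_0=x_0,\quad\tilde Z_{k+1}=Z_k+f(Z_k)\Delta+g(Z_k)\Delta B_k,\quad Z_{k+1}=\bar\pi_\Delta(\tilde Z_{k+1}).$$ *)

theory Defs
  imports "HOL-Probability.Probability"
begin

section \<open>Partial derivatives and continuous differentiability\<close>

definition has_partial :: "'d::finite \<Rightarrow> (real^'d \<Rightarrow> real) \<Rightarrow> real^'d \<Rightarrow> bool" where
  "has_partial i V x \<longleftrightarrow> (\<lambda>t. V (x + t *\<^sub>R axis i 1)) field_differentiable at 0"

definition partial :: "'d::finite \<Rightarrow> (real^'d \<Rightarrow> real) \<Rightarrow> real^'d \<Rightarrow> real" where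
  "partial i V x = deriv (\<lambda>t. V (x + t *\<^sub>R axis i 1)) 0"

fun cont_differentiable :: "nat \<Rightarrow> (real^'d::finite \<Rightarrow> real) \<Rightarrow> bool" where
  "cont_differentiable 0 V \<longleftrightarrow> continuous_on UNIV V"
| "cont_differentiable (Suc n) V \<longleftrightarrow> continuous_on UNIV V \<and>
     (\<forall>i. (\<forall>x. has_partial i V x) \<and> cont_differentiable n (partial i V))"

text \<open>
  A multiindex is a function \<open>\<alpha> :: 'd \<Rightarrow> nat\<close> of order \<open>\<Sum>i. \<alpha> i\<close>. The partial derivatives in
  \<open>D\<^sup>\<alpha>\<close> are taken in a fixed order depending only on \<open>\<alpha>\<close>; for functions that are
  continuously differentiable up to the order of \<open>\<alpha>\<close>, to which alone it is applied, the order is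
  immaterial by Schwarz's theorem.
\<close>

definition multi_partial :: "('d::finite \<Rightarrow> nat) \<Rightarrow> (real^'d \<Rightarrow> real) \<Rightarrow> real^'d \<Rightarrow> real" where
  "multi_partial \<alpha> V = foldr partial (SOME is. \<forall>i. count_list is i = \<alpha> i) V"

definition norm_deriv :: "nat \<Rightarrow> (real^'d::finite \<Rightarrow> real) \<Rightarrow> real^'d \<Rightarrow> real" where
  "norm_deriv n V x = sqrt (\<Sum>\<alpha> | (\<Sum>i\<in>UNIV. \<alpha> i) = n. \<bar>multi_partial \<alpha> V x\<bar>\<^sup>2)"

definition gradient :: "(real^'d::finite \<Rightarrow> real) \<Rightarrow> real^'d \<Rightarrow> real^'d" where
  "gradient V x = (\<chi> i. partial i V x)"

definition hessian :: "(real^'d::finite \<Rightarrow> real) \<Rightarrow> real^'d \<Rightarrow> real^'d^'d" where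
  "hessian V x = (\<chi> i j. partial i (partial j V) x)"


section \<open>Lyapunov functions\<close>

definition Ker :: "(real^'d::finite \<Rightarrow> real) \<Rightarrow> (real^'d) set" where
  "Ker h = {x. h x = 0}"

definition C_inf :: "nat \<Rightarrow> (real^'d::finite \<Rightarrow> real) set" where
  "C_inf p = {V. cont_differentiable p V \<and> (\<forall>x. 0 \<le> V x) \<and> filterlim V at_top at_infinity}"

text \<open>
  In the library \<open>0 powr 0 = 0\<close>, whereas \<open>V\<^sup>1\<^sup>-\<^sup>n\<^sup>\<delta>\<close> is the constant 1 when \<open>n\<delta> = 1\<close>,
  also at the origin, where \<open>V\<close> vanishes.
\<close>

definition rpow :: "real \<Rightarrow> real \<Rightarrow> real" where
  "rpow y a = (if a = 0 then 1 else y powr a)"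

definition lyapunov_class :: "nat \<Rightarrow> real \<Rightarrow> (real^'d::finite \<Rightarrow> real) set" where
  "lyapunov_class p \<delta> = {V \<in> C_inf p. Ker V = {0} \<and>
     (\<exists>c>0. \<forall>n\<in>{1..p}. \<forall>x. norm_deriv n V x \<le> c * rpow (V x) (1 - real n * \<delta>))}"

definition gen ::
  "(real^'d::finite \<Rightarrow> real^'d) \<Rightarrow> (real^'d \<Rightarrow> real^'m::finite^'d) \<Rightarrow> (real^'d \<Rightarrow> real) \<Rightarrow> real^'d \<Rightarrow> real"
  where
  "gen f g V x = gradient V x \<bullet> f x + 1 / 2 * trace (transpose (g x) ** hessian V x ** g x)"

definition gen_powr ::
  "(real^'d::finite \<Rightarrow> real^'d) \<Rightarrow> (real^'d \<Rightarrow> real^'m::finite^'d) \<Rightarrow> (real^'d \<Rightarrow> real) \<Rightarrow> real \<Rightarrow> real^'d \<Rightarrow> real"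
  where
  "gen_powr f g V \<rho> x = (if x = 0 then 0 else
     \<rho> / 2 * V x powr (\<rho> - 2) * (2 * V x * gen f g V x + (\<rho> - 1) * (norm (gradient V x v* g x))\<^sup>2))"

text \<open>Only used for \<open>x \<noteq> 0\<close>, where \<open>V x > 0\<close>.\<close>

definition Lambda :: "(real^'d::finite \<Rightarrow> real) \<Rightarrow> (real^'d \<Rightarrow> real) \<Rightarrow> real \<Rightarrow> real^'d \<Rightarrow> real" where
  "Lambda V w \<rho> x = min 1 (w x / V x powr \<rho>)"

text \<open>
  The quotients below are taken in \<^typ>\<open>ennreal\<close>, where \<open>0 / 0 = 0\<close> and \<open>a / 0 = \<infinity>\<close>
  for \<open>a > 0\<close>: where \<^const>\<open>Lambda\<close> vanishes, so must the numerators.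
\<close>

lemma ennreal_quotient_conventions:
  "(0::ennreal) / 0 = 0" "0 < a \<Longrightarrow> ennreal a / 0 = \<infinity>"
  by (simp_all add: ennreal_divide_eq_top_iff)

definition growth_sup ::
  "(real^'d::finite \<Rightarrow> real^'d) \<Rightarrow> (real^'d \<Rightarrow> real^'m::finite^'d) \<Rightarrow> (real^'d \<Rightarrow> real) \<Rightarrow> (real^'d \<Rightarrow> real)
    \<Rightarrow> real \<Rightarrow> real \<Rightarrow> real \<Rightarrow> ennreal" where
  "growth_sup f g V w \<rho> \<delta> u = (SUP x\<in>{x. 0 < norm x \<and> norm x \<le> u}.
     ennreal (max ((norm (f x))\<^sup>2) ((norm (g x))\<^sup>2)) / ennreal (Lambda V w \<rho> x * V x powr (2 * \<delta>)))"

definition scheme_sup ::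
  "(real^'d::finite \<Rightarrow> real^'d) \<Rightarrow> (real^'d \<Rightarrow> real^'m::finite^'d) \<Rightarrow> (real^'d \<Rightarrow> real) \<Rightarrow> (real^'d \<Rightarrow> real)
    \<Rightarrow> real \<Rightarrow> real \<Rightarrow> real \<Rightarrow> ennreal" where
  "scheme_sup f g V w \<rho> \<delta> u = (SUP x\<in>{x. 0 < norm x \<and> norm x \<le> u}.
     max (ennreal (norm (f x)) / ennreal (Lambda V w \<rho> x powr (1 / 2) * V x powr \<delta>))
         (ennreal ((norm (g x))\<^sup>2) / ennreal (Lambda V w \<rho> x * V x powr (2 * \<delta>))))"


section \<open>Filtered probability spaces and Brownian motion\<close>

text \<open>Time is \<open>[0, \<infinity>)\<close>; the values of \<open>F\<close> and \<open>B\<close> at negative arguments are irrelevant.\<close>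

locale usual_stochastic_basis = prob_space M + complete_measure M
  for M :: "'a measure" and F :: "real \<Rightarrow> 'a measure" +
  assumes subalg: "0 \<le> t \<Longrightarrow> subalgebra M (F t)"
    and mono: "0 \<le> s \<Longrightarrow> s \<le> t \<Longrightarrow> sets (F s) \<subseteq> sets (F t)"
    and null_sets_initial: "null_sets M \<subseteq> sets (F 0)"
    and right_continuous: "0 \<le> t \<Longrightarrow> sets (F t) = (\<Inter>s\<in>{t<..}. sets (F s))"

definition brownian_motion ::
  "'a measure \<Rightarrow> (real \<Rightarrow> 'a measure) \<Rightarrow> (real \<Rightarrow> 'a \<Rightarrow> real^'m::finite) \<Rightarrow> bool" where
  "brownian_motion M F B \<longleftrightarrow>
     (\<forall>t\<ge>0. B t \<in> borel_measurable (F t)) \<and>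
     (AE \<omega> in M. B 0 \<omega> = 0) \<and>
     (AE \<omega> in M. continuous_on {0..} (\<lambda>t. B t \<omega>)) \<and>
     (\<forall>s t. 0 \<le> s \<and> s < t \<longrightarrow>
        prob_space.indep_set M (sets (F s))
          {(\<lambda>\<omega>. B t \<omega> - B s \<omega>) -` A \<inter> space M | A. A \<in> sets borel} \<and>
        distributed M lborel (\<lambda>\<omega>. B t \<omega> - B s \<omega>)
          (\<lambda>x. ennreal (\<Prod>i\<in>UNIV. normal_density 0 (sqrt (t - s)) (x $ i))))"


section \<open>The truncated Euler--Maruyama scheme\<close>

text \<open>\<^term>\<open>sgn x\<close> is \<open>x / |x|\<close>, and 0 at 0.\<close>

definition trunc_map :: "(real \<Rightarrow> real) \<Rightarrow> real \<Rightarrow> real \<Rightarrow> real \<Rightarrow> real^'d::finite \<Rightarrow> real^'d" where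
  "trunc_map \<phi> K \<theta> \<Delta> x = min (norm x) (the_inv_into {0<..} \<phi> (K * \<Delta> powr (- \<theta>))) *\<^sub>R sgn x"

primrec truncated_EM ::
  "(real^'d::finite \<Rightarrow> real^'d) \<Rightarrow> (real^'d \<Rightarrow> real^'m::finite^'d) \<Rightarrow> (real \<Rightarrow> 'a \<Rightarrow> real^'m)
    \<Rightarrow> (real \<Rightarrow> real) \<Rightarrow> real \<Rightarrow> real \<Rightarrow> real^'d \<Rightarrow> real \<Rightarrow> nat \<Rightarrow> 'a \<Rightarrow> real^'d" where
  "truncated_EM f g B \<phi> K \<theta> x0 \<Delta> 0 = (\<lambda>\<omega>. x0)"
| "truncated_EM f g B \<phi> K \<theta> x0 \<Delta> (Suc k) = (\<lambda>\<omega>.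
     let z = truncated_EM f g B \<phi> K \<theta> x0 \<Delta> k \<omega>
     in trunc_map \<phi> K \<theta> \<Delta>
          (z + \<Delta> *\<^sub>R f z + g z *v (B (real (Suc k) * \<Delta>) \<omega> - B (real k * \<Delta>) \<omega>)))"

end

theory Submission
  imports Defs
begin

text \<open>
  The truncation keeps the scheme, for fixed \<open>\<Delta>\<close>, in a ball on which \<open>V\<^sup>\<rho>\<close> is bounded, so the
  first claim costs nothing, and by compactness the other two follow once \<open>w (Z\<^sub>k) \<longlongrightarrow> 0\<close> almost
  surely. For this it suffices that the scheme inherits the Lyapunov decrease of the equation, i.e.
  that \<open>E V\<^sup>\<rho>(Z\<^sub>k\<^sub>+\<^sub>1) + \<Delta>/2 E w(Z\<^sub>k) \<le> E V\<^sup>\<rho>(Z\<^sub>k)\<close>: summing over \<open>k\<close> gives \<open>E \<Sum>\<^sub>k w(Z\<^sub>k) < \<infinity>\<close>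
  (lemma \<open>AE_tendsto_0_of_drift\<close>).

  For the decrease, let \<open>x\<close> be the current state, \<open>u = V\<^sup>\<delta>(x)\<close>, \<open>h = \<Delta> f(x)\<close> and \<open>k = g(x) \<xi>\<close> with
  a centred Gaussian vector \<open>\<xi>\<close> of covariance \<open>\<Delta>\<close>. The bounds on the derivatives of \<open>V\<close> say that
  differentiating costs a factor \<open>1/u\<close>. This is inherited by all powers of \<open>V\<close> (lemma \<open>symbol_powr\<close>),
  and it makes \<open>V\<^sup>\<delta>\<close> Lipschitz continuous (lemma \<open>gauge_lipschitz\<close>). Hence a Taylor expansion of
  \<open>W = V\<^sup>\<rho>\<close> around \<open>x\<close> has relative errors in powers of \<open>|h|/u\<close> and \<open>|k|/u\<close> as long as these
  are small, and otherwise the crude growth bound that follows from the Lipschitz property is as good.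
  Since \<open>\<xi>\<close> and \<open>-\<xi>\<close> have the same law, only \<open>W(x + h + k) + W(x + h - k)\<close> has to be expanded.
  The terms of first and third order in \<open>k\<close> cancel, so that the
  error is at most of the order of \<open>W(x)\<close> times the sum of \<open>(|h|/u)\<^sup>2\<close>, \<open>(|k|/u)\<^sup>4\<close> and a further
  power of \<open>|k|/u\<close> that accounts for the growth of \<open>W\<close>
  (lemma \<open>symmetric_increment\<close>).

  The expectation of the main terms is \<open>\<Delta>\<close> times the generator applied to \<open>V\<^sup>\<rho>\<close> (lemma
  \<open>gen_powr_eq\<close>), which is at most \<open>- \<Delta> w(x)\<close>. Inside the truncation ball, the choice of the radius bounds
  \<open>(|h|/u)\<^sup>2\<close> and the expectations of these powers of \<open>|k|/u\<close> by \<open>\<Lambda>(x) \<tau>\<^sup>2\<close> with \<open>\<tau> = K \<Delta>\<^sup>1\<^sup>-\<^sup>\<theta>\<close>, up to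
  constants. As \<open>\<Lambda> V\<^sup>\<rho> \<le> w\<close>, the total error is at most a constant times \<open>\<tau>\<^sup>2 w(x)\<close> (lemma
  \<open>one_step\<close>), and \<open>\<tau>\<^sup>2\<close> is of order \<open>\<Delta>\<^sup>2\<^sup>-\<^sup>2\<^sup>\<theta>\<close>, which is smaller than \<open>\<Delta>\<close> because
  \<open>\<theta> < 1/2\<close>. Finally the projection onto the ball does not increase \<open>V\<close>.
\<close>


section \<open>Partial derivatives\<close>

lemma add_right_comm: "(a::'a::ab_semigroup_add) + b + c = a + c + b"
  by (simp add: add_ac)

text \<open>
  The derivative along a coordinate line at a general parameter; the definition speaks of
  the parameter 0 only.
\<close>

lemma has_partial_imp_DERIV:
  fixes F :: "real^'d::finite \<Rightarrow> real"
  assumes "has_partial i F (x + t *\<^sub>R axis i 1)"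
  shows "((\<lambda>s. F (x + s *\<^sub>R axis i 1)) has_real_derivative partial i F (x + t *\<^sub>R axis i 1)) (at t)"
proof -
  let ?e = "axis i 1 :: real^'d"
  have "((\<lambda>s. F (x + t *\<^sub>R ?e + s *\<^sub>R ?e)) has_real_derivative partial i F (x + t *\<^sub>R ?e)) (at 0)"
    using assms unfolding has_partial_def partial_def
    by (simp add: field_differentiable_derivI)
  then have "((\<lambda>s. F (x + (s + t) *\<^sub>R ?e)) has_real_derivative partial i F (x + t *\<^sub>R ?e)) (at 0)"
    by (simp add: algebra_simps)
  then show ?thesis
    using DERIV_shift[of "\<lambda>s. F (x + s *\<^sub>R ?e)" _ 0 t] by simp
qed

lemma partial_mvt:
  fixes F :: "real^'d::finite \<Rightarrow> real"
  assumes "\<And>t. 0 \<le> t \<Longrightarrow> t \<le> 1 \<Longrightarrow> has_partial i F (x + (t * h) *\<^sub>R axis i 1)"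
  obtains t where "0 < t" "t < 1"
    "F (x + h *\<^sub>R axis i 1) - F x = h * partial i F (x + (t * h) *\<^sub>R axis i 1)"
proof -
  let ?e = "axis i 1 :: real^'d"
  have "((\<lambda>s. F (x + (s * h) *\<^sub>R ?e)) has_real_derivative partial i F (x + (t * h) *\<^sub>R ?e) * h) (at t)"
    if "0 \<le> t" "t \<le> 1" for t
    by (rule DERIV_chain2[where f="\<lambda>s. F (x + s *\<^sub>R ?e)" and g="\<lambda>s. s * h"])
       (use has_partial_imp_DERIV[OF assms[OF that]] in \<open>auto intro!: derivative_eq_intros\<close>)
  then obtain t where "0 < t" "t < 1"
    "F (x + (1 * h) *\<^sub>R ?e) - F (x + (0 * h) *\<^sub>R ?e) = (1 - 0) * (partial i F (x + (t * h) *\<^sub>R ?e) * h)"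
    using MVT2[of 0 1 "\<lambda>s. F (x + (s * h) *\<^sub>R ?e)" "\<lambda>t. partial i F (x + (t * h) *\<^sub>R ?e) * h"]
    by auto
  then show ?thesis by (intro that[of t]) (auto simp: mult.commute)
qed

text \<open>
  The second difference over a square is symmetric in \<open>i\<close> and \<open>j\<close>, whereas the mean value
  theorem, applied along \<open>i\<close> and then along \<open>j\<close>, produces the mixed derivative in that order. This
  is how the two orders of differentiation come to be compared.
\<close>

lemma mixed_difference_mvt:
  fixes F :: "real^'d::finite \<Rightarrow> real"
  assumes "0 < h" and F: "\<And>y. has_partial i F y" and iF: "\<And>y. has_partial j (partial i F) y"
  obtains p where "dist p x \<le> 2 * h"
    "F (x + h *\<^sub>R axis i 1 + h *\<^sub>R axis j 1) - F (x + h *\<^sub>R axis i 1) - F (x + h *\<^sub>R axis j 1) + F x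
       = h\<^sup>2 * partial j (partial i F) p"
proof -
  let ?i = "axis i 1 :: real^'d" and ?j = "axis j 1 :: real^'d"
  define G where "G = (\<lambda>s. F (x + h *\<^sub>R ?j + s *\<^sub>R ?i) - F (x + s *\<^sub>R ?i))"
  define G' where "G' = (\<lambda>s. partial i F (x + h *\<^sub>R ?j + s *\<^sub>R ?i) - partial i F (x + s *\<^sub>R ?i))"
  have "(G has_real_derivative G' s) (at s)" for s
    unfolding G_def G'_def by (intro DERIV_diff has_partial_imp_DERIV F)
  from MVT2[OF \<open>0 < h\<close> this] obtain s where s: "0 < s" "s < h" "G h - G 0 = (h - 0) * G' s"
    by blast
  obtain t where t: "0 < t" "t < 1"
    "partial i F (x + s *\<^sub>R ?i + h *\<^sub>R ?j) - partial i F (x + s *\<^sub>R ?i)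
       = h * partial j (partial i F) (x + s *\<^sub>R ?i + (t * h) *\<^sub>R ?j)"
    by (rule partial_mvt[of j "partial i F" "x + s *\<^sub>R ?i" h, OF iF])
  have Gh: "G h - G 0 = h\<^sup>2 * partial j (partial i F) (x + s *\<^sub>R ?i + (t * h) *\<^sub>R ?j)"
    unfolding s(3) G'_def add_right_comm[of x "h *\<^sub>R ?j" "s *\<^sub>R ?i"] t(3)
    by (simp only: power2_eq_square mult.assoc diff_zero)
  have "norm (s *\<^sub>R ?i + (t * h) *\<^sub>R ?j) \<le> s + t * h"
    using s t \<open>0 < h\<close> by (intro order_trans[OF norm_triangle_ineq]) (simp add: norm_axis_1)
  moreover have "t * h \<le> 1 * h" using t \<open>0 < h\<close> by (intro mult_right_mono) auto
  ultimately have "dist (x + s *\<^sub>R ?i + (t * h) *\<^sub>R ?j) x \<le> 2 * h"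
    using s(2) unfolding dist_norm add.assoc add_diff_cancel_left' by linarith
  moreover have "G h - G 0 = F (x + h *\<^sub>R ?i + h *\<^sub>R ?j) - F (x + h *\<^sub>R ?i) - F (x + h *\<^sub>R ?j) + F x"
    by (simp add: G_def add_ac)
  ultimately show ?thesis
    using Gh that by metis
qed

text \<open>
  Schwarz's theorem. Both orders of differentiation are recovered as limits of the same
  second difference, over squares of side \<open>h n\<close>.
\<close>

lemma partial_commute:
  fixes F :: "real^'d::finite \<Rightarrow> real"
  assumes "cont_differentiable 2 F"
  shows "partial i (partial j F) = partial j (partial i F)"
proof
  fix x
  have hp: "has_partial a F y" "has_partial b (partial a F) y"
    and ct: "continuous_on UNIV (partial b (partial a F))" for a b y
    using assms by (auto simp: numeral_2_eq_2)
  define h where "h n = inverse (real (Suc n))" for n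
  have h: "0 < h n" for n by (simp add: h_def)
  have "\<exists>p q. dist p x \<le> 2 * h n \<and> dist q x \<le> 2 * h n \<and>
      partial i (partial j F) p = partial j (partial i F) q" for n
  proof -
    let ?i = "axis i 1 :: real^'d" and ?j = "axis j 1 :: real^'d"
    obtain p where p: "dist p x \<le> 2 * h n"
      "F (x + h n *\<^sub>R ?j + h n *\<^sub>R ?i) - F (x + h n *\<^sub>R ?j) - F (x + h n *\<^sub>R ?i) + F x
        = (h n)\<^sup>2 * partial i (partial j F) p"
      by (rule mixed_difference_mvt[OF h hp])
    obtain q where q: "dist q x \<le> 2 * h n"
      "F (x + h n *\<^sub>R ?i + h n *\<^sub>R ?j) - F (x + h n *\<^sub>R ?i) - F (x + h n *\<^sub>R ?j) + F x
        = (h n)\<^sup>2 * partial j (partial i F) q"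
      by (rule mixed_difference_mvt[OF h hp])
    have "(h n)\<^sup>2 * partial i (partial j F) p = (h n)\<^sup>2 * partial j (partial i F) q"
      unfolding p(2)[symmetric] q(2)[symmetric] add_right_comm[of x "h n *\<^sub>R ?i" "h n *\<^sub>R ?j"]
      by simp
    then have "partial i (partial j F) p = partial j (partial i F) q" using h[of n] by simp
    with p q show ?thesis by blast
  qed
  then obtain p q where pq: "\<And>n. dist (p n) x \<le> 2 * h n" "\<And>n. dist (q n) x \<le> 2 * h n"
    "\<And>n. partial i (partial j F) (p n) = partial j (partial i F) (q n)" by metis
  have h0: "(\<lambda>n. 2 * h n) \<longlonglongrightarrow> 0"
    using tendsto_mult_left[OF LIMSEQ_inverse_real_of_nat, of 2] by (simp add: h_def)
  have "p \<longlonglongrightarrow> x" "q \<longlonglongrightarrow> x"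
    by (rule tendsto_dist_iff[THEN iffD2], rule tendsto_sandwich[OF _ _ tendsto_const h0]; simp add: pq(1,2))+
  have isc: "isCont (partial b (partial a F)) x" for a b
    using ct[of b a] by (simp add: continuous_on_eq_continuous_at)
  have "(\<lambda>n. partial i (partial j F) (p n)) \<longlonglongrightarrow> partial i (partial j F) x"
    "(\<lambda>n. partial j (partial i F) (q n)) \<longlonglongrightarrow> partial j (partial i F) x"
    by (intro isCont_tendsto_compose[OF isc] \<open>p \<longlonglongrightarrow> x\<close> \<open>q \<longlonglongrightarrow> x\<close>)+
  then show "partial i (partial j F) x = partial j (partial i F) x"
    unfolding pq(3) by (rule LIMSEQ_unique)
qed

text \<open>
  An increment \<open>h\<close> is built up one coordinate at a time, hence the induction over the set
  of coordinates in which \<open>h\<close> may be nonzero. Each coordinate contributes an error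
  \<open>\<epsilon> |h\<^sub>i|\<close> by the mean value theorem, for a neighbourhood that does not depend on the coordinate.
\<close>

lemma has_derivative_if_continuous_partials:
  fixes F :: "real^'d::finite \<Rightarrow> real"
  assumes "open S" "x \<in> S"
    and hp: "\<And>i y. y \<in> S \<Longrightarrow> has_partial i F y"
    and ct: "\<And>i. continuous_on S (partial i F)"
  shows "(F has_derivative (\<lambda>h. \<Sum>i\<in>UNIV. h $ i * partial i F x)) (at x)"
  unfolding has_derivative_at_alt
proof (intro conjI allI impI)
  show "bounded_linear (\<lambda>h::real^'d. \<Sum>i\<in>UNIV. h $ i * partial i F x)"
    by (intro bounded_linear_sum bounded_linear_mult_const bounded_linear_vec_nth)
next
  fix e :: real assume "0 < e"
  define N where "N = real CARD('d)"
  have N: "0 < N" by (simp add: N_def)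
  define \<epsilon> where "\<epsilon> = e / N"
  have \<epsilon>: "0 < \<epsilon>" using \<open>0 < e\<close> N by (simp add: \<epsilon>_def)
  have "eventually (\<lambda>y. y \<in> S \<and> (\<forall>i. \<bar>partial i F y - partial i F x\<bar> < \<epsilon>)) (nhds x)"
  proof (intro eventually_conj eventually_all_finite)
    show "eventually (\<lambda>y. y \<in> S) (nhds x)" using assms by (simp add: eventually_nhds_in_open)
    fix i
    have "isCont (partial i F) x" using ct[of i] assms by (simp add: continuous_on_eq_continuous_at)
    then have "(partial i F \<longlongrightarrow> partial i F x) (nhds x)" by (simp add: continuous_at tendsto_nhds_iff)
    then show "eventually (\<lambda>y. \<bar>partial i F y - partial i F x\<bar> < \<epsilon>) (nhds x)"
      using \<epsilon> by (auto simp: tendsto_iff dist_real_def)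
  qed
  then obtain d where d: "0 < d"
    "\<And>y. dist y x < d \<Longrightarrow> y \<in> S \<and> (\<forall>i. \<bar>partial i F y - partial i F x\<bar> < \<epsilon>)"
    by (auto simp: eventually_nhds_metric)
  have *: "\<bar>F (x + h) - F x - (\<Sum>i\<in>A. h $ i * partial i F x)\<bar> \<le> \<epsilon> * (\<Sum>i\<in>A. \<bar>h $ i\<bar>)"
    if "finite A" "norm h < d" "\<And>i. i \<notin> A \<Longrightarrow> h $ i = 0" for A h
    using that
  proof (induction A arbitrary: h rule: finite_induct)
    case empty
    then have "h = 0" by (simp add: vec_eq_iff)
    then show ?case by simp
  next
    case (insert i A)
    define h' where "h' = (\<chi> j. if j = i then 0 else h $ j)"
    have part: "norm (h' + (t * h $ i) *\<^sub>R axis i 1) \<le> norm h" if "0 \<le> t" "t \<le> 1" for t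
      using that by (intro norm_le_componentwise_cart)
        (auto simp: h'_def axis_def abs_mult mult_left_le_one_le)
    have h: "h = h' + h $ i *\<^sub>R axis i 1" by (auto simp: vec_eq_iff h'_def axis_def)
    then have h1: "x + h' + h $ i *\<^sub>R axis i 1 = x + h" by (simp add: add.assoc)
    have near: "has_partial i F (x + h' + (t * h $ i) *\<^sub>R axis i 1) \<and>
        \<bar>partial i F (x + h' + (t * h $ i) *\<^sub>R axis i 1) - partial i F x\<bar> < \<epsilon>"
      if "0 \<le> t" "t \<le> 1" for t
      using part[OF that] insert.prems hp d(2)[of "x + h' + (t * h $ i) *\<^sub>R axis i 1"]
      by (simp add: dist_norm algebra_simps)
    obtain t where t: "0 < t" "t < 1"
      "F (x + h' + h $ i *\<^sub>R axis i 1) - F (x + h') = h $ i * partial i F (x + h' + (t * h $ i) *\<^sub>R axis i 1)"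
      by (rule partial_mvt[of i F "x + h'" "h $ i"]) (use near in auto)
    have "\<bar>F (x + h) - F (x + h') - h $ i * partial i F x\<bar>
        = \<bar>h $ i\<bar> * \<bar>partial i F (x + h' + (t * h $ i) *\<^sub>R axis i 1) - partial i F x\<bar>"
      using t(3) unfolding h1 abs_mult[symmetric] right_diff_distrib
      by simp
    also have "\<dots> \<le> \<bar>h $ i\<bar> * \<epsilon>" using near[of t] t by (intro mult_left_mono) auto
    finally have 1: "\<bar>F (x + h) - F (x + h') - h $ i * partial i F x\<bar> \<le> \<bar>h $ i\<bar> * \<epsilon>" .
    have "norm h' < d" using part[of 0] insert.prems by simp
    then have "\<bar>F (x + h') - F x - (\<Sum>j\<in>A. h' $ j * partial j F x)\<bar> \<le> \<epsilon> * (\<Sum>j\<in>A. \<bar>h' $ j\<bar>)"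
      using insert.prems by (intro insert.IH) (auto simp: h'_def)
    moreover have "h' $ j = h $ j" if "j \<in> A" for j using that insert.hyps by (auto simp: h'_def)
    ultimately have "\<bar>F (x + h') - F x - (\<Sum>j\<in>A. h $ j * partial j F x)\<bar> \<le> \<epsilon> * (\<Sum>j\<in>A. \<bar>h $ j\<bar>)"
      by simp
    with 1 show ?case using insert.hyps by (simp add: algebra_simps)
  qed
  show "\<exists>d>0. \<forall>y. norm (y - x) < d \<longrightarrow>
      norm (F y - F x - (\<Sum>i\<in>UNIV. (y - x) $ i * partial i F x)) \<le> e * norm (y - x)"
  proof (intro exI[of _ d] conjI allI impI \<open>0 < d\<close>)
    fix y assume y: "norm (y - x) < d"
    have "\<bar>F (x + (y - x)) - F x - (\<Sum>i\<in>UNIV. (y - x) $ i * partial i F x)\<bar>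
        \<le> \<epsilon> * (\<Sum>i\<in>UNIV. \<bar>(y - x) $ i\<bar>)"
      by (rule *) (use y in auto)
    also have "\<dots> \<le> \<epsilon> * (\<Sum>i\<in>(UNIV::'d set). norm (y - x))"
      using \<epsilon> by (intro mult_left_mono sum_mono component_le_norm_cart) auto
    also have "\<dots> = e * norm (y - x)" using N by (simp add: \<epsilon>_def N_def)
    finally show "norm (F y - F x - (\<Sum>i\<in>UNIV. (y - x) $ i * partial i F x)) \<le> e * norm (y - x)"
      by simp
  qed
qed

lemma cont_differentiable_foldr:
  "cont_differentiable (n + length js) V \<Longrightarrow> cont_differentiable n (foldr partial js V)"
proof (induction js arbitrary: n)
  case (Cons j js)
  then have "cont_differentiable (Suc (n + length js)) V" by (metis add_Suc_right length_Cons)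
  then have "cont_differentiable (Suc n) (foldr partial js V)" by (intro Cons.IH) (simp only: add_Suc)
  then show ?case by simp
qed simp

lemma cont_differentiable_mono: "cont_differentiable n V \<Longrightarrow> m \<le> n \<Longrightarrow> cont_differentiable m V"
proof (induction n arbitrary: V m)
  case (Suc n)
  then show ?case by (cases m) auto
qed simp

lemma foldr_partial_move_front:
  assumes "cont_differentiable (Suc (length (js1 @ js2))) V"
  shows "foldr partial (js1 @ i # js2) V = foldr partial (i # js1 @ js2) V"
  using assms
proof (induction js1)
  case (Cons j js1)
  have "cont_differentiable 2 (foldr partial (js1 @ js2) V)"
    by (rule cont_differentiable_foldr, rule cont_differentiable_mono[OF Cons.prems]) simp
  then have "partial j (partial i (foldr partial (js1 @ js2) V))
    = partial i (partial j (foldr partial (js1 @ js2) V))"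
    by (rule partial_commute)
  moreover have "foldr partial (js1 @ i # js2) V = foldr partial (i # js1 @ js2) V"
    by (rule Cons.IH) (rule cont_differentiable_mono[OF Cons.prems], simp)
  ultimately show ?case by simp
qed simp

text \<open>
  Iterated partial derivatives depend only on how often each coordinate occurs, which makes the
  order chosen in \<^const>\<open>multi_partial\<close> immaterial.
\<close>

lemma foldr_partial_perm:
  assumes "mset is = mset js" "cont_differentiable (length is) V"
  shows "foldr partial is V = foldr partial js V"
  using assms
proof (induction "is" arbitrary: js)
  case (Cons i "is")
  have "i \<in> set js" using Cons.prems(1) by (metis list.set_intros(1) set_mset_mset)
  then obtain js1 js2 where js: "js = js1 @ i # js2" by (auto simp: in_set_conv_decomp)
  with Cons.prems(1) have eq: "mset is = mset (js1 @ js2)" by simp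
  have "foldr partial is V = foldr partial (js1 @ js2) V"
    by (rule Cons.IH[OF eq]) (rule cont_differentiable_mono[OF Cons.prems(2)], simp)
  moreover have "foldr partial (js1 @ i # js2) V = foldr partial (i # js1 @ js2) V"
    by (rule foldr_partial_move_front)
       (use Cons.prems(2) mset_eq_length[OF eq] in \<open>simp del: cont_differentiable.simps\<close>)
  ultimately show ?case by (simp add: js)
qed simp

lemma multi_partial_count_list:
  fixes V :: "real^'d::finite \<Rightarrow> real"
  assumes "cont_differentiable (length is) V"
  shows "multi_partial (count_list is) V = foldr partial is V"
proof -
  define js where "js = (SOME js. \<forall>i. count_list js i = count_list is i)"
  have "\<forall>i. count_list js i = count_list is i"
    unfolding js_def by (rule someI[of _ "is"]) simp
  then have "mset is = mset js" by (intro multiset_eqI) (simp add: count_mset)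
  then show ?thesis
    using foldr_partial_perm[OF _ assms, of js] by (simp add: multi_partial_def js_def)
qed

lemma sum_count_list_UNIV: "(\<Sum>i\<in>UNIV. count_list is (i::'d::finite)) = length is"
  using sum_count_set[of "is" UNIV] by simp

lemma finite_multiindices: "finite {\<alpha> :: 'd::finite \<Rightarrow> nat. (\<Sum>i\<in>UNIV. \<alpha> i) = n}"
proof (rule finite_subset)
  show "{\<alpha> :: 'd \<Rightarrow> nat. (\<Sum>i\<in>UNIV. \<alpha> i) = n} \<subseteq> Pi\<^sub>E UNIV (\<lambda>_. {..n})"
    by (auto intro: member_le_sum)
qed (simp add: finite_PiE)

lemma abs_foldr_partial_le_norm_deriv:
  fixes V :: "real^'d::finite \<Rightarrow> real"
  assumes "cont_differentiable (length is) V"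
  shows "\<bar>foldr partial is V x\<bar> \<le> norm_deriv (length is) V x"
proof -
  have "\<bar>multi_partial (count_list is) V x\<bar>\<^sup>2
      \<le> (\<Sum>\<alpha> | (\<Sum>i\<in>UNIV. \<alpha> i) = length is. \<bar>multi_partial \<alpha> V x\<bar>\<^sup>2)"
    by (rule member_le_sum) (auto simp: sum_count_list_UNIV finite_multiindices)
  then have "sqrt (\<bar>multi_partial (count_list is) V x\<bar>\<^sup>2) \<le> norm_deriv (length is) V x"
    unfolding norm_deriv_def by (rule real_sqrt_le_mono)
  then show ?thesis using assms by (simp add: multi_partial_count_list)
qed


section \<open>Functions with derivatives controlled by a gauge\<close>

text \<open>
  The functions of interest are smooth away from the origin only, so that identities between them
  hold only there; the complement of the origin being open, they can nevertheless be differentiated.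
\<close>

lemma partial_cong_off_0:
  fixes F G :: "real^'d::finite \<Rightarrow> real"
  assumes "\<And>y. y \<noteq> 0 \<Longrightarrow> F y = G y" "x \<noteq> 0"
  shows "has_partial i F x \<longleftrightarrow> has_partial i G x" "partial i F x = partial i G x"
proof -
  let ?e = "axis i 1 :: real^'d"
  have "((\<lambda>t. x + t *\<^sub>R ?e) \<longlongrightarrow> x + 0 *\<^sub>R ?e) (nhds 0)"
    by (intro tendsto_intros filterlim_ident)
  then have ev: "eventually (\<lambda>t. F (x + t *\<^sub>R ?e) = G (x + t *\<^sub>R ?e)) (nhds 0)"
    using tendsto_imp_eventually_ne[of "\<lambda>t. x + t *\<^sub>R ?e" x "nhds 0" 0] assms
    by (auto elim!: eventually_mono)
  then have *: "((\<lambda>t. F (x + t *\<^sub>R ?e)) has_real_derivative c) (at 0) \<longleftrightarrow>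
     ((\<lambda>t. G (x + t *\<^sub>R ?e)) has_real_derivative c) (at 0)" for c
    by (intro DERIV_cong_ev) auto
  show "has_partial i F x \<longleftrightarrow> has_partial i G x"
    by (simp add: has_partial_def field_differentiable_def *)
  show "partial i F x = partial i G x"
    by (simp add: partial_def deriv_def *)
qed

lemma has_partial_of_DERIV:
  assumes "((\<lambda>t. F (x + t *\<^sub>R axis i 1)) has_real_derivative c) (at 0)"
  shows "has_partial i F x" "partial i F x = c"
  using assms by (auto simp: has_partial_def partial_def field_differentiable_def DERIV_imp_deriv)

lemma has_partialD:
  "has_partial i F x \<Longrightarrow> ((\<lambda>t. F (x + t *\<^sub>R axis i 1)) has_real_derivative partial i F x) (at 0)"
  using has_partial_imp_DERIV[of i F x 0] by simp

text \<open>
  In the sense in which symbols of pseudodifferential operators have an order, \<open>F\<close> has order \<open>e\<close> with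
  respect to the gauge \<open>v\<close>: off the origin it is bounded by \<open>C v\<^sup>e\<close>, and each of up to \<open>n\<close>
  differentiations lowers the exponent by one. The same constant serves for all derivatives.
\<close>

fun symbol :: "(real^'d::finite \<Rightarrow> real) \<Rightarrow> nat \<Rightarrow> real \<Rightarrow> real \<Rightarrow> (real^'d \<Rightarrow> real) \<Rightarrow> bool" where
  "symbol v 0 e C F \<longleftrightarrow> continuous_on (-{0}) F \<and> (\<forall>x. x \<noteq> 0 \<longrightarrow> \<bar>F x\<bar> \<le> C * v x powr e)"
| "symbol v (Suc n) e C F \<longleftrightarrow> symbol v 0 e C F \<and>
     (\<forall>i. (\<forall>x. x \<noteq> 0 \<longrightarrow> has_partial i F x) \<and> symbol v n (e - 1) C (partial i F))"

lemma symbol_0: "symbol v n e C F \<Longrightarrow> symbol v 0 e C F"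
  by (cases n) auto

lemma symbol_bound: "symbol v n e C F \<Longrightarrow> x \<noteq> 0 \<Longrightarrow> \<bar>F x\<bar> \<le> C * v x powr e"
  using symbol_0 by fastforce

lemma symbol_cont: "symbol v n e C F \<Longrightarrow> continuous_on (-{0}) F"
  using symbol_0 by fastforce

lemma symbol_Suc_le: "symbol v (Suc n) e C F \<Longrightarrow> symbol v n e C F"
  by (induction n arbitrary: e F) auto

lemma symbol_le: "symbol v n e C F \<Longrightarrow> m \<le> n \<Longrightarrow> symbol v m e C F"
  by (induction n) (auto simp del: symbol.simps simp: le_Suc_eq dest: symbol_Suc_le)

lemma symbol_mono:
  assumes "symbol v n e C F" "C \<le> C'"
  shows "symbol v n e C' F"
proof -
  have *: "C * v x powr e \<le> C' * v x powr e" for x e using assms(2) by (intro mult_right_mono) auto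
  show ?thesis using assms(1) by (induction n arbitrary: e F) (auto intro: order_trans[OF _ *])
qed

text \<open>
  The order of a function is described by one constant for all partial derivatives, whereas
  the rules for products and powers produce one constant per coordinate.
\<close>

lemma symbol_finite_bound:
  fixes G :: "'b::finite \<Rightarrow> real^'d::finite \<Rightarrow> real"
  assumes "\<And>i. \<exists>C. symbol v n e C (G i)"
  obtains C where "0 \<le> C" "\<And>i. symbol v n e C (G i)"
proof -
  obtain c where c: "\<And>i. symbol v n e (c i) (G i)" using assms by metis
  show ?thesis
  proof (rule that)
    show "0 \<le> (\<Sum>i\<in>UNIV. \<bar>c i\<bar>)" by (simp add: sum_nonneg)
    fix i
    have "\<bar>c i\<bar> \<le> (\<Sum>i\<in>UNIV. \<bar>c i\<bar>)" by (intro member_le_sum) auto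
    then show "symbol v n e (\<Sum>i\<in>UNIV. \<bar>c i\<bar>) (G i)" by (intro symbol_mono[OF c]) auto
  qed
qed

lemma symbol_cong:
  assumes "\<And>x. x \<noteq> 0 \<Longrightarrow> F x = G x" "symbol v n e C F"
  shows "symbol v n e C G"
  using assms
proof (induction n arbitrary: e F G)
  case 0
  then show ?case by (auto cong: continuous_on_cong_simp)
next
  case (Suc n)
  have "symbol v 0 e C G" using Suc.prems by (auto cong: continuous_on_cong_simp)
  moreover have "symbol v n (e - 1) C (partial i G)" for i
    by (rule Suc.IH[of "partial i F"]) (use Suc.prems partial_cong_off_0(2)[of F G] in auto)
  ultimately show ?case using Suc.prems partial_cong_off_0(1)[of F G] by (auto simp del: symbol.simps(1))
qed

text \<open>
  Lets the partial derivatives be given by formulas that are correct off the origin, where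
  \<^const>\<open>partial\<close> itself would be awkward to rewrite under a further derivative.
\<close>

lemma symbol_SucI:
  assumes "symbol v 0 e C F"
    and "\<And>i x. x \<noteq> 0 \<Longrightarrow> ((\<lambda>t. F (x + t *\<^sub>R axis i 1)) has_real_derivative G i x) (at 0)"
    and "\<And>i. symbol v n (e - 1) C (G i)"
  shows "symbol v (Suc n) e C F"
proof -
  have "symbol v n (e - 1) C (partial i F)" for i
    by (rule symbol_cong[OF _ assms(3)[of i]]) (simp add: has_partial_of_DERIV(2)[OF assms(2)])
  with assms has_partial_of_DERIV(1)[OF assms(2)] show ?thesis by (simp del: symbol.simps(1))
qed

lemma symbol_add:
  assumes "symbol v n e C F" "symbol v n e D G"
  shows "symbol v n e (C + D) (\<lambda>x. F x + G x)"
  using assms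
proof (induction n arbitrary: e F G)
  case 0
  then show ?case by (auto intro!: continuous_intros order_trans[OF abs_triangle_ineq] simp: distrib_right add_mono)
next
  case (Suc n)
  show ?case
  proof (rule symbol_SucI)
    show "symbol v 0 e (C + D) (\<lambda>x. F x + G x)"
      using Suc.prems by (auto intro!: continuous_intros order_trans[OF abs_triangle_ineq] simp: distrib_right add_mono)
    show "symbol v n (e - 1) (C + D) (\<lambda>x. partial i F x + partial i G x)" for i
      using Suc.prems by (intro Suc.IH) auto
    show "((\<lambda>t. F (x + t *\<^sub>R axis i 1) + G (x + t *\<^sub>R axis i 1)) has_real_derivative
        partial i F x + partial i G x) (at 0)" if "x \<noteq> 0" for i x
      using Suc.prems that by (intro DERIV_add has_partialD) auto
  qed
qed

lemma symbol_cmult: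
  assumes "symbol v n e C F"
  shows "symbol v n e (\<bar>c\<bar> * C) (\<lambda>x. c * F x)"
  using assms
proof (induction n arbitrary: e F)
  case 0
  then show ?case by (auto intro!: continuous_intros mult_left_mono simp: abs_mult mult.assoc)
next
  case (Suc n)
  show ?case
  proof (rule symbol_SucI)
    show "symbol v 0 e (\<bar>c\<bar> * C) (\<lambda>x. c * F x)"
      using Suc.prems by (auto intro!: continuous_intros mult_left_mono simp: abs_mult mult.assoc)
    show "symbol v n (e - 1) (\<bar>c\<bar> * C) (\<lambda>x. c * partial i F x)" for i
      using Suc.prems by (intro Suc.IH) auto
    show "((\<lambda>t. c * F (x + t *\<^sub>R axis i 1)) has_real_derivative c * partial i F x) (at 0)"
      if "x \<noteq> 0" for i x
      using Suc.prems that by (intro DERIV_cmult has_partialD) auto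
  qed
qed

lemma symbol_sum:
  assumes "finite A" "\<And>i. i \<in> A \<Longrightarrow> symbol v n e (C i) (F i)"
  shows "symbol v n e (\<Sum>i\<in>A. C i) (\<lambda>x. \<Sum>i\<in>A. F i x)"
  using assms
proof (induction A rule: finite_induct)
  case empty
  have "symbol v n e 0 (\<lambda>x. 0)"
  proof (induction n arbitrary: e)
    case (Suc n)
    show ?case by (rule symbol_SucI[where G="\<lambda>_ _. 0"]) (use Suc in auto)
  qed simp
  then show ?case by simp
next
  case (insert i A)
  then show ?case by (auto simp del: symbol.simps intro!: symbol_add)
qed

lemma symbol_mult_0:
  assumes "symbol v 0 e C F" "symbol v 0 e' D G"
  shows "symbol v 0 (e + e') (C * D) (\<lambda>x. F x * G x)"
proof -
  have "\<bar>F x * G x\<bar> \<le> C * D * v x powr (e + e')" if "x \<noteq> 0" for x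
  proof -
    have "\<bar>F x\<bar> * \<bar>G x\<bar> \<le> (C * v x powr e) * (D * v x powr e')"
      using symbol_bound[OF assms(1) that] symbol_bound[OF assms(2) that]
      by (intro mult_mono) (auto intro: order_trans[OF abs_ge_zero])
    then show ?thesis by (simp add: abs_mult powr_add mult_ac)
  qed
  then show ?thesis using assms by (auto intro!: continuous_intros)
qed

lemma symbol_mult:
  fixes v :: "real^'d::finite \<Rightarrow> real"
  assumes "symbol v n e C F" "symbol v n e' D G"
  shows "\<exists>c. symbol v n (e + e') c (\<lambda>x. F x * G x)"
  using assms
proof (induction n arbitrary: e e' F G)
  case 0
  then show ?case using symbol_mult_0 by blast
next
  case (Suc n)
  have "\<exists>c. symbol v n (e + e' - 1) c (\<lambda>x. partial i F x * G x + F x * partial i G x)" for i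
  proof -
    have "\<exists>c. symbol v n ((e - 1) + e') c (\<lambda>x. partial i F x * G x)"
      by (intro Suc.IH symbol_Suc_le[OF Suc.prems(2)]) (use Suc.prems in simp)
    moreover have "\<exists>c. symbol v n (e + (e' - 1)) c (\<lambda>x. F x * partial i G x)"
      by (intro Suc.IH symbol_Suc_le[OF Suc.prems(1)]) (use Suc.prems in simp)
    ultimately show ?thesis using symbol_add by (fastforce simp: algebra_simps simp del: symbol.simps)
  qed
  then obtain c where c: "0 \<le> c"
    "\<And>i. symbol v n (e + e' - 1) c (\<lambda>x. partial i F x * G x + F x * partial i G x)"
    by (rule symbol_finite_bound[where G="\<lambda>i x. partial i F x * G x + F x * partial i G x"]) blast
  have "symbol v 0 (e + e') (C * D) (\<lambda>x. F x * G x)"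
    by (intro symbol_mult_0 symbol_0[OF Suc.prems(1)] symbol_0[OF Suc.prems(2)])
  then have "symbol v (Suc n) (e + e') (max c (C * D)) (\<lambda>x. F x * G x)"
  proof (rule symbol_SucI[OF symbol_mono])
    show "symbol v n (e + e' - 1) (max c (C * D)) (\<lambda>x. partial i F x * G x + F x * partial i G x)" for i
      by (rule symbol_mono[OF c(2)]) simp
    show "((\<lambda>t. F (x + t *\<^sub>R axis i 1) * G (x + t *\<^sub>R axis i 1)) has_real_derivative
        partial i F x * G x + F x * partial i G x) (at 0)" if "x \<noteq> 0" for i x
      using DERIV_mult[OF has_partialD has_partialD, of i F x i G] Suc.prems that
      by (simp add: add.commute mult.commute)
  qed simp
  then show ?case ..
qed

lemma partial_powr:
  assumes "has_partial i V x" "0 < V x"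
  shows "((\<lambda>t. V (x + t *\<^sub>R axis i 1) powr a) has_real_derivative
     a * (V x powr (a - 1) * partial i V x)) (at 0)"
  using DERIV_fun_powr[OF has_partialD[OF assms(1)], of a] assms(2)
  by (simp add: mult.assoc)

text \<open>
  By the chain rule a partial derivative of \<open>V\<^sup>a\<close> is \<open>V\<^sup>a\<^sup>-\<^sup>1\<close> times one of \<open>V\<close>, and the order
  of this product is one less than that of \<open>V\<^sup>a\<close>. The induction on the smoothness therefore has to
  treat all exponents \<open>a\<close> at once.
\<close>

lemma symbol_powr:
  fixes v V :: "real^'d::finite \<Rightarrow> real"
  assumes "symbol v n s C V" and v: "\<And>x. x \<noteq> 0 \<Longrightarrow> 0 < v x" and V: "\<And>x. x \<noteq> 0 \<Longrightarrow> V x = v x powr s"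
  shows "\<exists>c. symbol v n (a * s) c (\<lambda>x. V x powr a)"
  using assms(1)
proof (induction n arbitrary: a)
  case 0
  have "continuous_on (-{0}) (\<lambda>x. V x powr a)"
    using 0 v V by (intro continuous_intros) (auto simp: powr_eq_0_iff less_le)
  moreover have "\<bar>V x powr a\<bar> \<le> 1 * v x powr (a * s)" if "x \<noteq> 0" for x
    by (simp add: V[OF that] powr_powr mult.commute)
  ultimately show ?case by (auto intro!: exI[of _ 1])
next
  case (Suc n)
  have Vn: "symbol v n s C V" by (rule symbol_Suc_le) fact
  have "\<exists>c. symbol v n (a * s - 1) c (\<lambda>x. a * (V x powr (a - 1) * partial i V x))" for i
  proof -
    obtain c where "symbol v n ((a - 1) * s) c (\<lambda>x. V x powr (a - 1))" using Suc.IH Vn by blast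
    moreover have "symbol v n (s - 1) C (partial i V)" using Suc.prems by simp
    ultimately obtain c' where "symbol v n ((a - 1) * s + (s - 1)) c' (\<lambda>x. V x powr (a - 1) * partial i V x)"
      using symbol_mult by blast
    from symbol_cmult[OF this, of a] show ?thesis by (auto simp: algebra_simps simp del: symbol.simps)
  qed
  then obtain c where c: "0 \<le> c"
    "\<And>i. symbol v n (a * s - 1) c (\<lambda>x. a * (V x powr (a - 1) * partial i V x))"
    by (rule symbol_finite_bound[where G="\<lambda>i x. a * (V x powr (a - 1) * partial i V x)"]) blast
  obtain c' where c': "symbol v n (a * s) c' (\<lambda>x. V x powr a)" using Suc.IH Vn by blast
  have "symbol v (Suc n) (a * s) (max c c') (\<lambda>x. V x powr a)"
  proof (rule symbol_SucI[OF symbol_mono[OF symbol_0[OF c']]])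
    show "symbol v n (a * s - 1) (max c c') (\<lambda>x. a * (V x powr (a - 1) * partial i V x))" for i
      by (rule symbol_mono[OF c(2)]) simp
    show "((\<lambda>t. V (x + t *\<^sub>R axis i 1) powr a) has_real_derivative
        a * (V x powr (a - 1) * partial i V x)) (at 0)" if "x \<noteq> 0" for i x
      using Suc.prems that v[OF that] by (intro partial_powr) (auto simp: V[OF that] simp del: symbol.simps(1))
  qed simp
  then show ?case ..
qed

definition dir_deriv :: "real^'d::finite \<Rightarrow> (real^'d \<Rightarrow> real) \<Rightarrow> real^'d \<Rightarrow> real" where
  "dir_deriv k F x = (\<Sum>i\<in>UNIV. k $ i * partial i F x)"

lemma symbol_dir_deriv:
  fixes v :: "real^'d::finite \<Rightarrow> real"
  assumes "symbol v (Suc n) e C F" "0 \<le> C"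
  shows "symbol v n (e - 1) (real CARD('d) * norm k * C) (dir_deriv k F)"
proof -
  have "symbol v n (e - 1) (\<Sum>i\<in>(UNIV::'d set). norm k * C) (dir_deriv k F)"
    unfolding dir_deriv_def
  proof (rule symbol_sum)
    fix i
    have "symbol v n (e - 1) (\<bar>k $ i\<bar> * C) (\<lambda>x. k $ i * partial i F x)"
      using assms by (intro symbol_cmult) simp
    then show "symbol v n (e - 1) (norm k * C) (\<lambda>x. k $ i * partial i F x)"
      by (rule symbol_mono) (intro mult_right_mono component_le_norm_cart assms)
  qed simp
  then show ?thesis by (simp add: mult.assoc)
qed

lemma symbol_dir_deriv_pow:
  fixes v :: "real^'d::finite \<Rightarrow> real"
  assumes "symbol v (m + n) e C F" "0 \<le> C"
  shows "symbol v n (e - real m) ((real CARD('d) * norm k) ^ m * C) ((dir_deriv k ^^ m) F)"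
  using assms
proof (induction m arbitrary: n)
  case (Suc m)
  have "symbol v (Suc n) (e - real m) ((real CARD('d) * norm k) ^ m * C) ((dir_deriv k ^^ m) F)"
    using Suc.prems by (intro Suc.IH) (auto simp del: symbol.simps)
  then have "symbol v n (e - real m - 1) (real CARD('d) * norm k * ((real CARD('d) * norm k) ^ m * C))
      (dir_deriv k ((dir_deriv k ^^ m) F))"
    using Suc.prems by (intro symbol_dir_deriv) auto
  then show ?case by (simp add: algebra_simps del: symbol.simps)
qed simp

text \<open>
  This is where the passage from partial to total derivatives is used: it makes the iterated
  \<^term>\<open>dir_deriv k\<close> the successive derivatives of a function of one real variable, to which
  Taylor's theorem applies.
\<close>

lemma dir_deriv_line:
  fixes v :: "real^'d::finite \<Rightarrow> real"
  assumes "symbol v (Suc n) e C F" "x + t *\<^sub>R k \<noteq> 0"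
  shows "((\<lambda>s. F (x + s *\<^sub>R k)) has_real_derivative dir_deriv k F (x + t *\<^sub>R k)) (at t)"
proof -
  have "(F has_derivative (\<lambda>h. \<Sum>i\<in>UNIV. h $ i * partial i F (x + t *\<^sub>R k))) (at (x + t *\<^sub>R k))"
    by (rule has_derivative_if_continuous_partials[of "-{0}"])
       (use assms in \<open>auto intro: symbol_cont[where v=v and n=n and e="e - 1" and C=C]\<close>)
  moreover have "((\<lambda>s. x + s *\<^sub>R k) has_derivative (\<lambda>s. s *\<^sub>R k)) (at t)"
    by (auto intro!: derivative_eq_intros)
  ultimately have "((\<lambda>s. F (x + s *\<^sub>R k)) has_derivative
      (\<lambda>s. \<Sum>i\<in>UNIV. (s *\<^sub>R k) $ i * partial i F (x + t *\<^sub>R k))) (at t)"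
    by (rule has_derivative_compose[rotated])
  then show ?thesis
    unfolding has_field_derivative_def dir_deriv_def
    by (rule has_derivative_eq_rhs) (simp add: fun_eq_iff sum_distrib_left mult_ac)
qed

text \<open>
  The list \<open>is\<close> records the derivatives already taken, so that the bounds on all iterated
  partial derivatives can be collected by induction on the number \<open>n\<close> of those still to come.
\<close>

lemma symbol_of_cont_differentiable:
  fixes V v :: "real^'d::finite \<Rightarrow> real"
  assumes "cont_differentiable N V"
    and bnd: "\<And>is x. length is \<le> N \<Longrightarrow> x \<noteq> 0 \<Longrightarrow> \<bar>foldr partial is V x\<bar> \<le> C * v x powr (s - real (length is))"
    and "length is + n \<le> N"
  shows "symbol v n (s - real (length is)) C (foldr partial is V)"
  using assms(3)
proof (induction n arbitrary: "is")
  case 0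
  have "cont_differentiable 0 (foldr partial is V)"
    by (rule cont_differentiable_foldr) (rule cont_differentiable_mono[OF assms(1)], use 0 in simp)
  then show ?case using bnd[of "is"] 0 by (auto intro: continuous_on_subset)
next
  case (Suc n)
  have "cont_differentiable (Suc 0) (foldr partial is V)"
    by (rule cont_differentiable_foldr) (rule cont_differentiable_mono[OF assms(1)], use Suc in simp)
  moreover have "symbol v n (s - real (length is) - 1) C (partial i (foldr partial is V))" for i
    using Suc.IH[of "i # is"] Suc.prems by (simp add: algebra_simps del: symbol.simps)
  ultimately show ?case
    using bnd[of "is"] Suc.prems by (auto intro: continuous_on_subset)
qed


section \<open>Taylor estimates relative to the gauge\<close>

lemma dir_deriv_pow_2:
  assumes "symbol v 2 e C F" "x \<noteq> 0"
  shows "(dir_deriv k ^^ 2) F x = (\<Sum>i\<in>UNIV. \<Sum>j\<in>UNIV. k $ i * k $ j * partial i (partial j F) x)"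
proof -
  have s: "symbol v 1 (e - 1) C (partial j F)" for j
    using assms(1) by (simp add: numeral_2_eq_2)
  have "partial i (dir_deriv k F) x = (\<Sum>j\<in>UNIV. k $ j * partial i (partial j F) x)" for i
    unfolding dir_deriv_def
    by (rule has_partial_of_DERIV(2), intro DERIV_sum DERIV_cmult has_partialD) (use s assms(2) in auto)
  then show ?thesis
    by (simp add: numeral_2_eq_2 dir_deriv_def sum_distrib_left mult.assoc)
qed

text \<open>
  The bound \<open>M\<close> on the gauge is required on the segment on both sides of \<open>z\<close>, as the expansion is
  used for \<open>\<sigma> = 1\<close> and \<open>\<sigma> = - 1\<close> with the same derivatives along \<open>k\<close>.
\<close>

lemma symbol_taylor:
  fixes v F :: "real^'d::finite \<Rightarrow> real"
  assumes F: "symbol v n e C F" and "0 < n" "0 \<le> C"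
    and seg: "\<And>t. \<bar>t\<bar> \<le> 1 \<Longrightarrow> z + t *\<^sub>R k \<noteq> 0 \<and> v (z + t *\<^sub>R k) powr (e - real n) \<le> M"
    and \<sigma>: "\<bar>\<sigma>\<bar> = 1"
  shows "\<bar>F (z + \<sigma> *\<^sub>R k) - (\<Sum>m<n. (dir_deriv k ^^ m) F z / fact m * \<sigma> ^ m)\<bar>
      \<le> (real CARD('d) * norm k) ^ n * C * M / fact n"
proof -
  define D where "D m t = (dir_deriv k ^^ m) F (z + t *\<^sub>R k)" for m t
  have "DERIV (D m) t :> D (Suc m) t" if "m < n" "\<bar>t\<bar> \<le> 1" for m t
  proof -
    have "symbol v (m + Suc (n - m - 1)) e C F" using F \<open>m < n\<close> by simp
    from dir_deriv_line[OF symbol_dir_deriv_pow[OF this \<open>0 \<le> C\<close>], of z t k k] seg[OF that(2)]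
    show ?thesis by (simp add: D_def[abs_def])
  qed
  then have "\<exists>t. (if \<sigma> < 0 then \<sigma> < t \<and> t < 0 else 0 < t \<and> t < \<sigma>) \<and>
      D 0 \<sigma> = (\<Sum>m<n. D m 0 / fact m * (\<sigma> - 0) ^ m) + D n t / fact n * (\<sigma> - 0) ^ n"
    using \<open>0 < n\<close> \<sigma> by (intro Taylor[where a="-1" and b=1]) auto
  then obtain t where t': "if \<sigma> < 0 then \<sigma> < t \<and> t < 0 else 0 < t \<and> t < \<sigma>"
    and "D 0 \<sigma> = (\<Sum>m<n. D m 0 / fact m * (\<sigma> - 0) ^ m) + D n t / fact n * (\<sigma> - 0) ^ n"
    by blast
  moreover have "\<bar>t\<bar> \<le> 1" using t' \<sigma> by (auto split: if_splits)
  ultimately have t: "\<bar>t\<bar> \<le> 1"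
    "D 0 \<sigma> = (\<Sum>m<n. D m 0 / fact m * \<sigma> ^ m) + D n t / fact n * \<sigma> ^ n"
    by simp_all
  have "symbol v 0 (e - real n) ((real CARD('d) * norm k) ^ n * C) ((dir_deriv k ^^ n) F)"
    using F \<open>0 \<le> C\<close> by (intro symbol_dir_deriv_pow) auto
  from symbol_bound[OF this, of "z + t *\<^sub>R k"] seg[OF t(1)]
  have "\<bar>D n t\<bar> \<le> (real CARD('d) * norm k) ^ n * C * v (z + t *\<^sub>R k) powr (e - real n)"
    by (simp add: D_def)
  also have "\<dots> \<le> (real CARD('d) * norm k) ^ n * C * M"
    using seg[OF t(1)] \<open>0 \<le> C\<close> by (intro mult_left_mono) auto
  finally have "\<bar>D n t / fact n * \<sigma> ^ n\<bar> \<le> (real CARD('d) * norm k) ^ n * C * M / fact n"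
    using \<sigma> by (simp add: abs_mult power_abs divide_right_mono)
  then show ?thesis using t(2) by (simp add: D_def)
qed

lemma mvt_unit_interval:
  fixes f :: "real \<Rightarrow> real"
  assumes "continuous_on {0..1} f" "\<And>t. 0 < t \<Longrightarrow> t < 1 \<Longrightarrow> (f has_real_derivative f' t) (at t)"
  shows "\<exists>t. 0 < t \<and> t < 1 \<and> f 1 - f 0 = (1 - 0) * f' t"
  using mvt[of 0 1 f "\<lambda>t. (*) (f' t)"] assms by (auto simp: has_field_derivative_def)

text \<open>
  Away from the origin the gradient of \<open>v\<close> has order 0, i.e. it is bounded. A segment
  through the origin is cut there, where \<open>v\<close> need not be differentiable but is continuous.
\<close>

lemma gauge_lipschitz:
  fixes v :: "real^'d::finite \<Rightarrow> real"
  assumes v: "symbol v 1 1 C v" "0 \<le> C" and pos: "\<And>x. x \<noteq> 0 \<Longrightarrow> 0 < v x"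
    and cont: "continuous_on UNIV v"
  shows "\<bar>v y - v x\<bar> \<le> real CARD('d) * C * norm (y - x)"
proof -
  have *: "\<bar>v (x + k) - v x\<bar> \<le> real CARD('d) * C * norm k"
    if avoid: "\<And>t. 0 < t \<Longrightarrow> t < 1 \<Longrightarrow> x + t *\<^sub>R k \<noteq> 0" for x k
  proof -
    have "\<exists>t. 0 < t \<and> t < 1 \<and> v (x + 1 *\<^sub>R k) - v (x + 0 *\<^sub>R k) = (1 - 0) * dir_deriv k v (x + t *\<^sub>R k)"
    proof (rule mvt_unit_interval)
      show "continuous_on {0..1} (\<lambda>t. v (x + t *\<^sub>R k))"
        by (intro continuous_on_compose2[OF cont] continuous_intros) auto
      show "((\<lambda>t. v (x + t *\<^sub>R k)) has_real_derivative dir_deriv k v (x + t *\<^sub>R k)) (at t)"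
        if "0 < t" "t < 1" for t
        by (rule dir_deriv_line[OF v(1)[unfolded One_nat_def]]) (rule avoid[OF that])
    qed
    then obtain t where t: "0 < t" "t < 1" "v (x + k) - v x = dir_deriv k v (x + t *\<^sub>R k)"
      by auto
    have "symbol v 0 (1 - 1) (real CARD('d) * norm k * C) (dir_deriv k v)"
      by (rule symbol_dir_deriv) (use v in \<open>simp_all only: One_nat_def\<close>)
    from symbol_bound[OF this avoid[OF t(1,2)]] pos[OF avoid[OF t(1,2)]]
    show ?thesis unfolding t(3) by (simp add: mult_ac)
  qed
  show ?thesis
  proof (cases "\<exists>t. 0 < t \<and> t < 1 \<and> x + t *\<^sub>R (y - x) = 0")
    case False
    with *[of x "y - x"] show ?thesis by auto
  next
    case True
    then obtain t where t: "0 < t" "t < 1" "x + t *\<^sub>R (y - x) = 0" by auto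
    have x: "x = - (t *\<^sub>R (y - x))" using t(3) by (simp add: eq_neg_iff_add_eq_0)
    have y: "y = (1 - t) *\<^sub>R (y - x)"
      using t(3) by (simp add: scaleR_left_diff_distrib algebra_simps)
    have "norm x + norm y = t * norm (y - x) + (1 - t) * norm (y - x)"
      using t arg_cong[OF x, of norm] arg_cong[OF y, of norm]
      by (simp only: norm_minus_cancel norm_scaleR abs_of_pos diff_gt_0_iff_gt)
    then have n: "norm x + norm y = norm (y - x)" by (simp add: algebra_simps)
    have r: "\<bar>v z - v 0\<bar> \<le> real CARD('d) * C * norm z" for z
      by (cases "z = 0") (use *[of 0 z] in auto)
    have "\<bar>v y - v x\<bar> \<le> real CARD('d) * C * norm x + real CARD('d) * C * norm y"
      using r[of x] r[of y] by linarith
    then show ?thesis using n by (metis distrib_left)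
  qed
qed

lemma powr_le_of_comparable:
  fixes u y :: real
  assumes "0 < u" "u / 2 \<le> y" "y \<le> 2 * u"
  shows "y powr e \<le> 2 powr \<bar>e\<bar> * u powr e"
proof (cases "0 \<le> e")
  case True
  then have "y powr e \<le> (2 * u) powr e" using assms by (intro powr_mono2) auto
  then show ?thesis using True assms by (simp add: powr_mult)
next
  case False
  then have "y powr e \<le> (u / 2) powr e" using assms by (intro powr_mono2') auto
  also have "\<dots> = 2 powr \<bar>e\<bar> * u powr e"
    using False assms by (simp add: powr_divide powr_minus_divide)
  finally show ?thesis .
qed

lemma powr_diff_numeral_scaled:
  fixes u k :: real
  assumes "0 < u"
  shows "u powr (r - real n) * k ^ n = u powr r * (k / u) ^ n"
  using assms by (simp add: powr_diff powr_realpow power_divide)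

text \<open>
  If the increments are small compared with \<open>v x\<close>, the Lipschitz property keeps \<open>v\<close> within a
  factor 2 of \<open>v x\<close> on all segments involved, and therefore away from the origin. Expanding
  to fourth order along \<open>\<plusminus>k\<close> around \<open>x + h\<close> cancels the odd terms; what remains is moved from
  \<open>x + h\<close> to \<open>x\<close> by expanding \<open>W\<close> to second order and its second derivative to first order along
  \<open>h\<close>. The mixed error \<open>|h| |k|\<^sup>2\<close> is absorbed by the other two.
\<close>

lemma symmetric_increment_near:
  fixes v W :: "real^'d::finite \<Rightarrow> real"
  assumes W: "symbol v 4 r C W" "0 \<le> C"
    and v: "v 0 = 0" "\<And>x. x \<noteq> 0 \<Longrightarrow> 0 < v x" "\<And>x y. \<bar>v y - v x\<bar> \<le> L * norm (y - x)" "0 < L"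
    and x: "x \<noteq> 0" "W x = v x powr r" and small: "2 * L * (norm h + norm k) \<le> v x"
  shows "W (x + h + k) + W (x + h - k) \<le> 2 * W x + 2 * dir_deriv h W x + (dir_deriv k ^^ 2) W x
     + 2 * C * (2 powr \<bar>r - 2\<bar> + 2 powr \<bar>r - 3\<bar> + 2 powr \<bar>r - 4\<bar>) * real CARD('d) ^ 4 *
        (W x * ((norm h / v x)\<^sup>2 + (norm k / v x) ^ 4))"
proof -
  define u where "u = v x"
  define N where "N = real CARD('d)"
  define M where "M j = 2 powr \<bar>r - j\<bar> * u powr (r - j)" for j
  have u: "0 < u" and N: "1 \<le> N" using v x by (auto simp: u_def N_def Suc_leI)
  have near: "y \<noteq> 0 \<and> v y powr (r - j) \<le> M j" if "norm (y - x) \<le> norm h + norm k" for y j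
  proof -
    have "L * norm (y - x) \<le> L * (norm h + norm k)" using that v by (intro mult_left_mono) auto
    with small v(3)[of y x] have "u / 2 \<le> v y" "v y \<le> 2 * u" by (auto simp: u_def)
    with u v(1) show ?thesis unfolding M_def by (auto intro!: powr_le_of_comparable)
  qed
  have part: "norm (t *\<^sub>R a) \<le> norm a" if "\<bar>t\<bar> \<le> 1" for t and a :: "real^'d"
    using that by (simp add: mult_left_le_one_le)
  have seg_h: "x + t *\<^sub>R h \<noteq> 0 \<and> v (x + t *\<^sub>R h) powr (r - j) \<le> M j" if "\<bar>t\<bar> \<le> 1" for t j
    using part[OF that, of h] norm_ge_zero[of k]
    by (intro near) (simp only: add_diff_cancel_left')
  have seg_k: "x + h + t *\<^sub>R k \<noteq> 0 \<and> v (x + h + t *\<^sub>R k) powr (r - j) \<le> M j" if "\<bar>t\<bar> \<le> 1" for t j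
  proof (rule near)
    have "norm (h + t *\<^sub>R k) \<le> norm h + norm k"
      using norm_triangle_ineq[of h "t *\<^sub>R k"] part[OF that, of k] by linarith
    then show "norm (x + h + t *\<^sub>R k - x) \<le> norm h + norm k" by (simp add: add.assoc)
  qed
  define R4 where "R4 = (N * norm k) ^ 4 * C * M 4"
  define R3 where "R3 = (N * norm h) * ((N * norm k)\<^sup>2 * C) * M 3"
  define R2 where "R2 = (N * norm h)\<^sup>2 * C * M 2"
  have R4: "0 \<le> R4" and R2: "0 \<le> R2" and R3: "0 \<le> R3"
    using N W by (auto simp: R4_def R3_def R2_def M_def)
  have t: "\<bar>W (x + h + \<sigma> *\<^sub>R k) - (\<Sum>m<4. (dir_deriv k ^^ m) W (x + h) / fact m * \<sigma> ^ m)\<bar> \<le> R4 / 24"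
    if "\<bar>\<sigma>\<bar> = 1" for \<sigma>
    using symbol_taylor[OF W(1) _ W(2) _ that, of "x + h" k "M 4"] seg_k[of _ 4]
    by (simp add: R4_def N_def fact_numeral)
  have sums: "(\<Sum>m<4. f m) = f 0 + f 1 + f 2 + f 3" "(\<Sum>m<2. f m) = f 0 + f 1" for f :: "nat \<Rightarrow> real"
    by (simp_all add: numeral_eq_Suc)
  have 1: "W (x + h + k) + W (x + h - k) \<le> 2 * W (x + h) + (dir_deriv k ^^ 2) W (x + h) + R4"
    using abs_le_D1[OF t[of 1]] abs_le_D1[OF t[of "-1"]] R4 unfolding sums
    by (simp add: fact_numeral)
  have "symbol v 1 (r - 2) ((N * norm k)\<^sup>2 * C) ((dir_deriv k ^^ 2) W)"
    using symbol_dir_deriv_pow[of v 2 1 r C W k] symbol_le[OF W(1), of 3] W(2)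
    by (simp add: N_def numeral_eq_Suc)
  from symbol_taylor[OF this, of x h "M 3" 1] seg_h[of _ 3]
  have 2: "(dir_deriv k ^^ 2) W (x + h) \<le> (dir_deriv k ^^ 2) W x + R3"
    using N W by (simp add: R3_def N_def)
  have "\<bar>W (x + 1 *\<^sub>R h) - (\<Sum>m<2. (dir_deriv h ^^ m) W x / fact m * 1 ^ m)\<bar> \<le> R2 / fact 2"
    unfolding R2_def N_def
    by (rule symbol_taylor[OF symbol_le[OF W(1)]]) (use W(2) seg_h[of _ 2] in auto)
  from abs_le_D1[OF this] have 3: "2 * W (x + h) \<le> 2 * W x + 2 * dir_deriv h W x + R2"
    unfolding sums by simp
  define a s where "a = norm h / u" and "s = norm k / u"
  have nh: "norm h = a * u" and nk: "norm k = s * u" and a: "0 \<le> a" and s: "0 \<le> s"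
    using u by (auto simp: a_def s_def)
  have Wx: "W x = u powr r" using x by (simp add: u_def)
  define Q where "Q = W x * (a\<^sup>2 + s ^ 4)"
  have Q: "0 \<le> Q" by (simp add: Q_def Wx)
  have M': "M j * u ^ j = 2 powr \<bar>r - real j\<bar> * W x" for j :: nat
    using u by (simp add: M_def Wx powr_diff powr_realpow)
  have R4eq: "R4 = N ^ 4 * C * s ^ 4 * (M 4 * u ^ 4)"
    by (simp add: R4_def nk power_mult_distrib)
  have R3eq: "R3 = N ^ 3 * C * (a * s\<^sup>2) * (M 3 * u ^ 3)"
    by (simp add: R3_def nh nk power_mult_distrib power2_eq_square power3_eq_cube)
  have R2eq: "R2 = N\<^sup>2 * C * a\<^sup>2 * (M 2 * u\<^sup>2)"
    by (simp add: R2_def nh power_mult_distrib)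
  have N4: "N ^ j \<le> N ^ 4" if "j \<le> 4" for j using N that by (rule power_increasing[rotated])
  have gen: "N ^ j * C * p * (M (real j) * u ^ j) \<le> N ^ 4 * C * 2 powr \<bar>r - real j\<bar> * Q"
    if "j \<le> 4" "0 \<le> p" "p \<le> a\<^sup>2 + s ^ 4" for j p
  proof -
    have "N ^ j * (C * (p * (2 powr \<bar>r - real j\<bar> * W x))) \<le> N ^ 4 * (C * ((a\<^sup>2 + s ^ 4) * (2 powr \<bar>r - real j\<bar> * W x)))"
      using N4[OF that(1)] W(2) that N by (intro mult_mono mult_nonneg_nonneg) (auto simp: Wx)
    then show ?thesis unfolding M' by (simp add: Q_def mult_ac)
  qed
  \<comment> \<open>the inequality of arithmetic and geometric means, for the mixed error term\<close>
  have "0 \<le> (a - s\<^sup>2)\<^sup>2" by simp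
  then have "2 * (a * s\<^sup>2) \<le> a\<^sup>2 + s ^ 4" by (simp add: power2_diff flip: power_mult)
  then have as: "a * s\<^sup>2 \<le> a\<^sup>2 + s ^ 4" using a by (smt (verit) mult_nonneg_nonneg zero_le_power2)
  have "R4 + R3 + R2 \<le> N ^ 4 * C * 2 powr \<bar>r - 4\<bar> * Q + N ^ 4 * C * 2 powr \<bar>r - 3\<bar> * Q + N ^ 4 * C * 2 powr \<bar>r - 2\<bar> * Q"
    using gen[of 4 "s ^ 4"] gen[of 3 "a * s\<^sup>2"] gen[of 2 "a\<^sup>2"] as a s
    unfolding R4eq R3eq R2eq by (intro add_mono) auto
  also have "\<dots> = 1 * C * (2 powr \<bar>r - 2\<bar> + 2 powr \<bar>r - 3\<bar> + 2 powr \<bar>r - 4\<bar>) * N ^ 4 * Q"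
    by (simp add: algebra_simps)
  also have "\<dots> \<le> 2 * C * (2 powr \<bar>r - 2\<bar> + 2 powr \<bar>r - 3\<bar> + 2 powr \<bar>r - 4\<bar>) * N ^ 4 * Q"
    using W(2) N Q by (intro mult_right_mono) auto
  finally show ?thesis using 1 2 3 by (simp add: N_def Q_def a_def s_def u_def)
qed

text \<open>
  If the increments are not small compared with \<open>v x\<close>, there is nothing to expand: every
  term is at most a power of \<open>b\<close>, where \<open>b v(x)\<close> bounds \<open>v\<close> at the points in question and
  \<open>b \<ge> 1\<close>. So all of them are dominated by the highest power, \<open>b\<^sup>q\<close>.
\<close>

lemma symmetric_increment_far:
  fixes v W :: "real^'d::finite \<Rightarrow> real"
  assumes W: "symbol v 4 r C W" "0 \<le> C" "\<And>y. W y = v y powr r" "0 \<le> r" "r \<le> real q" "2 \<le> q"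
    and v: "\<And>y. 0 \<le> v y" "\<And>x y. \<bar>v y - v x\<bar> \<le> L * norm (y - x)" "1 \<le> L"
    and x: "x \<noteq> 0" "0 < v x" and h: "norm h \<le> v x" and large: "v x \<le> 2 * L * (norm h + norm k)"
  shows "W (x + h + k) + W (x + h - k) \<le> 2 * W x + 2 * dir_deriv h W x + (dir_deriv k ^^ 2) W x
     + (2 + 3 * C) * real CARD('d) ^ 2 * (6 * L) ^ q *
        (W x * ((norm h / v x)\<^sup>2 + (norm k / v x) ^ q))"
proof -
  define u where "u = v x"
  define N where "N = real CARD('d)"
  have u: "0 < u" and N: "1 \<le> N" using x by (auto simp: u_def N_def Suc_leI)
  define a s where "a = norm h / u" and "s = norm k / u"
  have nh: "norm h = a * u" and nk: "norm k = s * u" and a: "0 \<le> a" "a \<le> 1" and s: "0 \<le> s"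
    using u h by (auto simp: a_def s_def u_def)
  \<comment> \<open>\<open>v \<le> (1 + L (a + s)) u\<close> at all points in question, and \<open>1 \<le> 2 L (a + s)\<close> as the increments are large\<close>
  define b where "b = 3 * L * (a + s)"
  have "u * 1 \<le> u * (2 * (L * (a + s)))" using large by (simp add: nh nk u_def[symmetric] algebra_simps)
  then have La: "1 \<le> 2 * (L * (a + s))" using u by (simp only: mult_le_cancel_left_pos)
  have b1: "1 \<le> b" using La by (simp add: b_def)
  have "1 * (a + s) \<le> (3 * L) * (a + s)" using v(3) a s by (intro mult_right_mono) auto
  then have ab: "a \<le> b" and sb: "s \<le> b" using a s by (auto simp: b_def)
  have Wx: "W x = u powr r" by (simp add: W(3) u_def)
  have bnd: "W y \<le> W x * b ^ q" if "norm (y - x) \<le> norm h + norm k" for y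
  proof -
    have "L * norm (y - x) \<le> L * (norm h + norm k)" using that v by (intro mult_left_mono) auto
    with v(2)[of y x] have "v y \<le> u * (1 + L * (a + s))"
      by (simp add: u_def[symmetric] nh nk algebra_simps)
    also have "\<dots> \<le> u * b" using La u by (intro mult_left_mono) (auto simp: b_def)
    finally have "v y powr r \<le> (u * b) powr r" using v(1) W(4) by (intro powr_mono2) auto
    also have "\<dots> = u powr r * b powr r" using u b1 by (simp add: powr_mult)
    also have "\<dots> \<le> u powr r * b powr real q" using b1 W(5) by (intro mult_left_mono powr_mono) auto
    finally show ?thesis using b1 by (simp add: W(3) u_def powr_realpow)
  qed
  have pw: "c ^ j \<le> b ^ q" if "0 \<le> c" "c \<le> b" "j \<le> q" for c j
    using power_mono[OF that(2,1), of j] power_increasing[OF that(3) b1] by linarith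
  have "W (x + h + k) \<le> W x * b ^ q"
    by (rule bnd) (simp add: norm_triangle_ineq add.assoc)
  moreover have "W (x + h - k) \<le> W x * b ^ q"
  proof (rule bnd)
    have "x + h - k - x = h - k" by simp
    then show "norm (x + h - k - x) \<le> norm h + norm k" by (simp only: norm_triangle_ineq4)
  qed
  moreover have "\<bar>dir_deriv h W x\<bar> \<le> N ^ 2 * C * (W x * b ^ q)"
  proof -
    have "symbol v 0 (r - real 1) ((N * norm h) ^ 1 * C) ((dir_deriv h ^^ 1) W)"
      unfolding N_def by (rule symbol_dir_deriv_pow[OF symbol_le[OF W(1)] W(2)]) simp
    from symbol_bound[OF this x(1)]
    have "\<bar>dir_deriv h W x\<bar> \<le> N * C * (u powr (r - real 1) * norm h ^ 1)" by (simp add: u_def mult_ac)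
    also have "\<dots> = N ^ 1 * C * (W x * a ^ 1)"
      unfolding powr_diff_numeral_scaled[OF u] by (simp add: Wx a_def)
    also have "\<dots> \<le> N ^ 2 * C * (W x * b ^ q)"
      using W N a ab pw[of a 1] power_increasing[of 1 2 N]
      by (intro mult_mono) (auto simp: Wx)
    finally show ?thesis .
  qed
  moreover have "\<bar>(dir_deriv k ^^ 2) W x\<bar> \<le> N ^ 2 * C * (W x * b ^ q)"
  proof -
    have "symbol v 0 (r - real 2) ((N * norm k) ^ 2 * C) ((dir_deriv k ^^ 2) W)"
      unfolding N_def by (rule symbol_dir_deriv_pow[OF symbol_le[OF W(1)] W(2)]) simp
    from symbol_bound[OF this x(1)]
    have "\<bar>(dir_deriv k ^^ 2) W x\<bar> \<le> N ^ 2 * C * (u powr (r - real 2) * norm k ^ 2)"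
      by (simp add: u_def mult_ac power_mult_distrib)
    also have "\<dots> = N ^ 2 * C * (W x * s ^ 2)"
      unfolding powr_diff_numeral_scaled[OF u] by (simp add: Wx s_def)
    also have "\<dots> \<le> N ^ 2 * C * (W x * b ^ q)"
      using W N s sb pw[of s 2] by (intro mult_mono) (auto simp: Wx)
    finally show ?thesis .
  qed
  moreover have "0 \<le> W x" by (simp add: Wx)
  ultimately have "W (x + h + k) + W (x + h - k) \<le> 2 * W x + 2 * dir_deriv h W x + (dir_deriv k ^^ 2) W x
      + (2 * (W x * b ^ q) + 3 * (N ^ 2 * C * (W x * b ^ q)))" by linarith
  also have "2 * (W x * b ^ q) + 3 * (N ^ 2 * C * (W x * b ^ q)) \<le> (2 + 3 * C) * N ^ 2 * (W x * b ^ q)"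
  proof -
    have "1 * (W x * b ^ q) \<le> N ^ 2 * (W x * b ^ q)"
      using N b1 by (intro mult_right_mono) (auto simp: Wx)
    then show ?thesis by (simp add: algebra_simps)
  qed
  also have "\<dots> \<le> (2 + 3 * C) * N ^ 2 * (W x * ((6 * L) ^ q * (a\<^sup>2 + s ^ q)))"
  proof -
    have "(a + s) ^ q \<le> 2 ^ q * (a\<^sup>2 + s ^ q)"
    proof (cases "s \<le> a")
      case True
      then have "(a + s) ^ q \<le> (2 * a) ^ q" using a s by (intro power_mono) auto
      also have "\<dots> \<le> 2 ^ q * (a\<^sup>2 + s ^ q)"
        using power_decreasing[OF W(6) a] s by (simp add: power_mult_distrib add_increasing2)
      finally show ?thesis .
    next
      case False
      then have "(a + s) ^ q \<le> (2 * s) ^ q" using a s by (intro power_mono) auto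
      then show ?thesis by (simp add: power_mult_distrib distrib_left add_increasing)
    qed
    then have "(3 * L) ^ q * (a + s) ^ q \<le> (3 * L) ^ q * (2 ^ q * (a\<^sup>2 + s ^ q))"
      using v(3) by (intro mult_left_mono) auto
    also have "\<dots> = (3 * L * 2) ^ q * (a\<^sup>2 + s ^ q)"
      by (simp only: power_mult_distrib mult.assoc)
    finally have "(3 * L * (a + s)) ^ q \<le> (3 * L * 2) ^ q * (a\<^sup>2 + s ^ q)"
      by (simp only: power_mult_distrib)
    then have "b ^ q \<le> (6 * L) ^ q * (a\<^sup>2 + s ^ q)" by (simp add: b_def)
    then show ?thesis using W(2) by (intro mult_left_mono) (auto simp: Wx)
  qed
  finally show ?thesis by (simp add: N_def a_def s_def u_def mult_ac)
qed

text \<open>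
  The near and the far estimate combined, with a constant uniform in \<open>x\<close>, \<open>h\<close> and \<open>k\<close>. This
  holds without any restriction on \<open>k\<close>, as is needed for integrating over a Gaussian \<open>k\<close>.
\<close>

lemma symmetric_increment:
  fixes v W :: "real^'d::finite \<Rightarrow> real"
  assumes W: "symbol v 4 r C W" "0 \<le> C" "\<And>y. W y = v y powr r" "0 \<le> r" "r \<le> real q" "2 \<le> q"
    and v: "v 0 = 0" "\<And>x. x \<noteq> 0 \<Longrightarrow> 0 < v x" "\<And>x y. \<bar>v y - v x\<bar> \<le> L * norm (y - x)" "1 \<le> L"
  obtains c where "0 \<le> c" "\<And>x h k. x \<noteq> 0 \<Longrightarrow> norm h \<le> v x \<Longrightarrow>
    W (x + h + k) + W (x + h - k) \<le> 2 * W x + 2 * dir_deriv h W x + (dir_deriv k ^^ 2) W x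
      + c * (W x * ((norm h / v x)\<^sup>2 + (norm k / v x) ^ 4 + (norm k / v x) ^ q))"
proof -
  define c1 where "c1 = 2 * C * (2 powr \<bar>r - 2\<bar> + 2 powr \<bar>r - 3\<bar> + 2 powr \<bar>r - 4\<bar>) * real CARD('d) ^ 4"
  define c2 where "c2 = (2 + 3 * C) * real CARD('d) ^ 2 * (6 * L) ^ q"
  have c: "0 \<le> c1" "0 \<le> c2" using W(2) v(4) by (auto simp: c1_def c2_def)
  show ?thesis
  proof (rule that)
    show "0 \<le> c1 + c2" using c by simp
    fix x h k :: "real^'d" assume x: "x \<noteq> 0" and h: "norm h \<le> v x"
    define a s where "a = norm h / v x" and "s = norm k / v x"
    have L0: "0 < L" using v(4) by linarith
    have v0: "0 \<le> v y" for y using v(1) v(2)[of y] by (cases "y = 0") auto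
    have as: "0 \<le> a" "0 \<le> s" using v0 by (auto simp: a_def s_def)
    have le: "c' * (W x * p) \<le> (c1 + c2) * (W x * (a\<^sup>2 + s ^ 4 + s ^ q))"
      if "0 \<le> c'" "c' \<le> c1 + c2" "0 \<le> p" "p \<le> a\<^sup>2 + s ^ 4 + s ^ q" for c' p
      using that as by (intro mult_mono) (auto simp: W(3))
    show "W (x + h + k) + W (x + h - k) \<le> 2 * W x + 2 * dir_deriv h W x + (dir_deriv k ^^ 2) W x
      + (c1 + c2) * (W x * ((norm h / v x)\<^sup>2 + (norm k / v x) ^ 4 + (norm k / v x) ^ q))"
    proof (cases "2 * L * (norm h + norm k) \<le> v x")
      case True
      have "W (x + h + k) + W (x + h - k) \<le> 2 * W x + 2 * dir_deriv h W x + (dir_deriv k ^^ 2) W x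
         + c1 * (W x * (a\<^sup>2 + s ^ 4))"
        unfolding c1_def a_def s_def
        by (rule symmetric_increment_near[OF W(1,2) v(1-3) L0 x W(3) True])
      also have "c1 * (W x * (a\<^sup>2 + s ^ 4)) \<le> (c1 + c2) * (W x * (a\<^sup>2 + s ^ 4 + s ^ q))"
        using c as by (intro le) auto
      finally show ?thesis by (simp add: a_def s_def)
    next
      case False
      have "W (x + h + k) + W (x + h - k) \<le> 2 * W x + 2 * dir_deriv h W x + (dir_deriv k ^^ 2) W x
         + c2 * (W x * (a\<^sup>2 + s ^ q))"
        unfolding c2_def a_def s_def
        by (rule symmetric_increment_far[OF W v0 v(3,4) x v(2)[OF x] h]) (use False in linarith)
      also have "c2 * (W x * (a\<^sup>2 + s ^ q)) \<le> (c1 + c2) * (W x * (a\<^sup>2 + s ^ 4 + s ^ q))"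
        using c as by (intro le) auto
      finally show ?thesis by (simp add: a_def s_def)
    qed
  qed
qed


section \<open>Centred Gaussian vectors\<close>

lemma prod_Basis_cart:
  "(\<Prod>b\<in>(Basis :: (real^'m::finite) set). F b) = (\<Prod>i\<in>UNIV. F (axis i 1))"
proof -
  have B: "(Basis :: (real^'m) set) = range (\<lambda>i. axis i 1)" by (auto simp: Basis_vec_def)
  have inj: "inj (\<lambda>i. axis i 1 :: real^'m)" by (auto simp: inj_def axis_eq_axis)
  show ?thesis unfolding B by (subst prod.reindex[OF inj]) simp
qed

lemma nn_integral_lborel_cart_prod:
  fixes f :: "'m::finite \<Rightarrow> real \<Rightarrow> ennreal"
  assumes [measurable]: "\<And>i. f i \<in> borel_measurable borel"
  shows "(\<integral>\<^sup>+x. (\<Prod>i\<in>UNIV. f i (x $ i)) \<partial>(lborel :: (real^'m) measure)) = (\<Prod>i\<in>UNIV. \<integral>\<^sup>+y. f i y \<partial>lborel)"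
proof -
  define idx :: "real^'m \<Rightarrow> 'm" where "idx b = (SOME i. b = axis i 1)" for b
  have idx: "idx (axis i 1) = i" for i by (simp add: idx_def axis_eq_axis)
  have "(\<integral>\<^sup>+x. (\<Prod>b\<in>Basis. f (idx b) (x \<bullet> b)) \<partial>(lborel :: (real^'m) measure))
      = (\<Prod>b\<in>Basis. \<integral>\<^sup>+y. f (idx b) y \<partial>lborel)"
    by (rule nn_integral_lborel_prod) auto
  then show ?thesis by (simp add: prod_Basis_cart idx cart_eq_inner_axis[symmetric])
qed

definition gauss :: "real \<Rightarrow> (real^'m::finite) measure" where
  "gauss \<sigma> = density lborel (\<lambda>x. ennreal (\<Prod>i\<in>UNIV. normal_density 0 \<sigma> (x $ i)))"

lemma sets_gauss [measurable_cong, simp]: "sets (gauss \<sigma>) = sets borel"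
  by (simp add: gauss_def)

lemma space_gauss [simp]: "space (gauss \<sigma>) = UNIV"
  by (simp add: gauss_def)

lemma nn_integral_gauss_prod:
  fixes h :: "'m::finite \<Rightarrow> real \<Rightarrow> real"
  assumes [measurable]: "\<And>i. h i \<in> borel_measurable borel" and nn: "\<And>i y. 0 \<le> h i y"
  shows "(\<integral>\<^sup>+x. ennreal (\<Prod>i\<in>UNIV. h i (x $ i)) \<partial>gauss \<sigma>)
    = (\<Prod>i\<in>UNIV. \<integral>\<^sup>+y. ennreal (normal_density 0 \<sigma> y * h i y) \<partial>lborel)"
proof -
  have "(\<integral>\<^sup>+x. ennreal (\<Prod>i\<in>UNIV. h i (x $ i)) \<partial>(gauss \<sigma> :: (real^'m) measure))
      = (\<integral>\<^sup>+x. (\<Prod>i\<in>UNIV. ennreal (normal_density 0 \<sigma> (x $ i) * h i (x $ i))) \<partial>(lborel :: (real^'m) measure))"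
  proof -
    have "(\<Prod>i\<in>UNIV. ennreal (normal_density 0 \<sigma> (x $ i) * h i (x $ i)))
        = ennreal (\<Prod>i\<in>UNIV. normal_density 0 \<sigma> (x $ i)) * ennreal (\<Prod>i\<in>UNIV. h i (x $ i))" for x :: "real^'m"
      by (subst prod_ennreal) (simp_all only: prod.distrib ennreal_mult nn prod_nonneg normal_density_nonneg mult_nonneg_nonneg)
    then show ?thesis
      unfolding gauss_def by (subst nn_integral_density) auto
  qed
  also have "\<dots> = (\<Prod>i\<in>UNIV. \<integral>\<^sup>+y. ennreal (normal_density 0 \<sigma> y * h i y) \<partial>lborel)"
    by (rule nn_integral_lborel_cart_prod) simp
  finally show ?thesis .
qed

lemma prob_space_gauss: 
  assumes "0 < \<sigma>"
  shows "prob_space (gauss \<sigma> :: (real^'m::finite) measure)"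
proof
  have "(\<integral>\<^sup>+y. ennreal (normal_density 0 \<sigma> y) \<partial>lborel) = 1"
    using assms by (subst nn_integral_eq_integral) (auto simp: integral_normal_density)
  then show "emeasure (gauss \<sigma> :: (real^'m) measure) (space (gauss \<sigma>)) = 1"
    using nn_integral_gauss_prod[of "\<lambda>(_::'m) _. 1" \<sigma>] by (simp add: nn_integral_const)
qed

lemma nn_integral_gauss_component_power:
  assumes "0 < \<sigma>"
  shows "(\<integral>\<^sup>+x. ennreal ((x $ i) ^ (2 * p)) \<partial>(gauss \<sigma> :: (real^'m::finite) measure))
    = ennreal (fact (2 * p) / (2 ^ p * fact p) * \<sigma> ^ (2 * p))"
proof -
  define h :: "'m \<Rightarrow> real \<Rightarrow> real" where "h j y = (if j = i then y ^ (2 * p) else 1)" for j y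
  have *: "(\<integral>\<^sup>+y. ennreal (normal_density 0 \<sigma> y * h j y) \<partial>lborel)
      = (if j = i then ennreal (fact (2 * p) / (2 ^ p * fact p) * \<sigma> ^ (2 * p)) else 1)" for j
  proof (cases "j = i")
    case True
    have "has_bochner_integral lborel (\<lambda>x. normal_density 0 \<sigma> x * x ^ (2 * p))
        (fact (2 * p) / ((2 / \<sigma>\<^sup>2) ^ p * fact p))"
      using normal_moment_even[of \<sigma> 0 p] assms by simp
    moreover have "fact (2 * p) / ((2 / \<sigma>\<^sup>2) ^ p * fact p) = fact (2 * p) / (2 ^ p * fact p) * \<sigma> ^ (2 * p)"
      using assms by (simp add: power_divide power_mult)
    ultimately show ?thesis
      using True by (simp add: h_def has_bochner_integral_iff nn_integral_eq_integral)
  next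
    case False
    then show ?thesis
      using assms by (simp add: h_def nn_integral_eq_integral)
  qed
  have "(\<integral>\<^sup>+x. ennreal (\<Prod>j\<in>UNIV. h j (x $ j)) \<partial>(gauss \<sigma> :: (real^'m) measure))
    = (\<Prod>j\<in>UNIV. \<integral>\<^sup>+y. ennreal (normal_density 0 \<sigma> y * h j y) \<partial>lborel)"
    by (rule nn_integral_gauss_prod) (auto simp: h_def[abs_def])
  moreover have "(\<Prod>j\<in>UNIV. h j (x $ j)) = (x $ i) ^ (2 * p)" for x
    by (simp add: h_def prod.delta)
  ultimately show ?thesis unfolding * by (simp add: prod.delta)
qed

lemma gauss_component_power:
  assumes "0 < \<sigma>"
  shows "integrable (gauss \<sigma> :: (real^'m::finite) measure) (\<lambda>x. (x $ i) ^ (2 * p))"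
    and "(\<integral>x. (x $ i) ^ (2 * p) \<partial>(gauss \<sigma> :: (real^'m) measure))
      = fact (2 * p) / (2 ^ p * fact p) * \<sigma> ^ (2 * p)"
proof -
  have "0 \<le> fact (2 * p) / (2 ^ p * fact p) * \<sigma> ^ (2 * p)" using assms by simp
  from nn_integral_eq_integrable[OF _ _ this, of "\<lambda>x. (x $ i) ^ (2 * p)" "gauss \<sigma> :: (real^'m) measure"]
    nn_integral_gauss_component_power[OF assms, of i p]
  show "integrable (gauss \<sigma> :: (real^'m::finite) measure) (\<lambda>x. (x $ i) ^ (2 * p))"
    "(\<integral>x. (x $ i) ^ (2 * p) \<partial>(gauss \<sigma> :: (real^'m) measure))
      = fact (2 * p) / (2 ^ p * fact p) * \<sigma> ^ (2 * p)"
    by simp_all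
qed

lemma norm_power_le_sum_component_powers:
  fixes x :: "real^'m::finite"
  shows "norm x ^ (2 * p) \<le> real CARD('m) ^ p * (\<Sum>i\<in>UNIV. (x $ i) ^ (2 * p))"
proof -
  obtain i where i: "\<And>j. (x $ j)\<^sup>2 \<le> (x $ i)\<^sup>2"
  proof -
    have "Max (range (\<lambda>j. (x $ j)\<^sup>2)) \<in> range (\<lambda>j. (x $ j)\<^sup>2)" by (rule Max_in) auto
    then obtain i where i: "Max (range (\<lambda>j. (x $ j)\<^sup>2)) = (x $ i)\<^sup>2" by blast
    have "(x $ j)\<^sup>2 \<le> Max (range (\<lambda>j. (x $ j)\<^sup>2))" for j by (rule Max_ge) auto
    then show ?thesis by (intro that[of i]) (simp only: i)
  qed
  have "(norm x)\<^sup>2 = (\<Sum>j\<in>UNIV. (x $ j)\<^sup>2)" by (simp add: norm_vec_def L2_set_def sum_nonneg)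
  also have "\<dots> \<le> (\<Sum>j\<in>(UNIV::'m set). (x $ i)\<^sup>2)" by (intro sum_mono i)
  finally have "((norm x)\<^sup>2) ^ p \<le> (real CARD('m) * (x $ i)\<^sup>2) ^ p" by (intro power_mono) auto
  then have "norm x ^ (2 * p) \<le> real CARD('m) ^ p * (x $ i) ^ (2 * p)"
    by (simp add: power_mult_distrib power_mult)
  also have "\<dots> \<le> real CARD('m) ^ p * (\<Sum>i\<in>UNIV. (x $ i) ^ (2 * p))"
    by (intro mult_left_mono member_le_sum) (auto simp: power_mult)
  finally show ?thesis .
qed

text \<open>
  The constant does not depend on \<open>\<sigma>\<close>: the moments scale like \<open>\<sigma>\<^sup>2\<^sup>p\<close>.
\<close>

lemma gauss_norm_moment:
  obtains c where "0 \<le> c" "\<And>\<sigma>. 0 < \<sigma> \<Longrightarrow> integrable (gauss \<sigma> :: (real^'m::finite) measure) (\<lambda>x. norm x ^ (2 * p))"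
    "\<And>\<sigma>. 0 < \<sigma> \<Longrightarrow> (\<integral>x. norm x ^ (2 * p) \<partial>(gauss \<sigma> :: (real^'m) measure)) \<le> c * \<sigma> ^ (2 * p)"
proof -
  define c where "c = real CARD('m) ^ p * (real CARD('m) * (fact (2 * p) / (2 ^ p * fact p)))"
  have int: "integrable (gauss \<sigma> :: (real^'m) measure) (\<lambda>x. real CARD('m) ^ p * (\<Sum>i\<in>UNIV. (x $ i) ^ (2 * p)))"
    if "0 < \<sigma>" for \<sigma>
    by (intro Bochner_Integration.integrable_mult_right Bochner_Integration.integrable_sum gauss_component_power that)
  have int': "integrable (gauss \<sigma> :: (real^'m) measure) (\<lambda>x. norm x ^ (2 * p))" if "0 < \<sigma>" for \<sigma>
    by (rule Bochner_Integration.integrable_bound[OF int[OF that]])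
       (auto intro!: order_trans[OF norm_power_le_sum_component_powers] abs_ge_self)
  show ?thesis
  proof (rule that[of c])
    show "0 \<le> c" by (simp add: c_def)
    fix \<sigma> :: real assume \<sigma>: "0 < \<sigma>"
    show "integrable (gauss \<sigma> :: (real^'m) measure) (\<lambda>x. norm x ^ (2 * p))" by (rule int'[OF \<sigma>])
    have "(\<integral>x. norm x ^ (2 * p) \<partial>(gauss \<sigma> :: (real^'m) measure))
      \<le> (\<integral>x. real CARD('m) ^ p * (\<Sum>i\<in>UNIV. (x $ i) ^ (2 * p)) \<partial>(gauss \<sigma> :: (real^'m) measure))"
      by (intro integral_mono int int' \<sigma> norm_power_le_sum_component_powers)
    also have "\<dots> = c * \<sigma> ^ (2 * p)"
      using \<sigma> by (simp add: Bochner_Integration.integral_sum gauss_component_power c_def)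
    finally show "(\<integral>x. norm x ^ (2 * p) \<partial>(gauss \<sigma> :: (real^'m) measure)) \<le> c * \<sigma> ^ (2 * p)" .
  qed
qed

text \<open>
  Reflecting coordinates preserves both Lebesgue measure and the density. This gives the
  symmetry of the law as well as the vanishing of the off-diagonal covariances.
\<close>

lemma distr_gauss_signs:
  fixes s :: "'m::finite \<Rightarrow> real"
  assumes s: "\<And>i. \<bar>s i\<bar> = 1"
  shows "distr (gauss \<sigma>) borel (\<lambda>x. \<chi> i. s i * x $ i) = gauss \<sigma>"
proof -
  define T :: "real^'m \<Rightarrow> real^'m" where "T = (\<lambda>x. \<chi> i. s i * x $ i)"
  define c :: "real^'m \<Rightarrow> real" where "c b = s (SOME i. b = axis i 1)" for b
  have c: "c (axis i 1) = s i" for i by (simp add: c_def axis_eq_axis)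
  have s0: "s i \<noteq> 0" for i using s[of i] by auto
  have T_eq: "T x = 0 + (\<Sum>j\<in>Basis. (c j * (x \<bullet> j)) *\<^sub>R j)" for x
  proof (rule euclidean_eqI)
    fix b :: "real^'m" assume b: "b \<in> Basis"
    then obtain i where "b = axis i 1" by (auto simp: Basis_vec_def)
    then have "T x \<bullet> b = c b * (x \<bullet> b)"
      by (simp add: T_def c cart_eq_inner_axis[symmetric])
    with b show "T x \<bullet> b = (0 + (\<Sum>j\<in>Basis. (c j * (x \<bullet> j)) *\<^sub>R j)) \<bullet> b"
      by (simp only: add_0 inner_sum_left_Basis)
  qed
  have T_meas [measurable]: "T \<in> borel_measurable borel"
    unfolding T_def by (intro borel_measurable_continuous_onI continuous_intros)
  have "lborel = density (distr lborel borel T) (\<lambda>_. (\<Prod>j\<in>Basis. \<bar>c j\<bar>))"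
    unfolding T_eq[abs_def] by (rule lborel_affine_euclidean) (use s0 c in \<open>auto simp: Basis_vec_def\<close>)
  then have lb: "distr lborel borel T = lborel"
    by (simp add: prod_Basis_cart c s density_1)
  have nd: "normal_density 0 \<sigma> (s i * y) = normal_density 0 \<sigma> y" for i y
  proof -
    have "s i = 1 \<or> s i = -1" using s[of i] by (simp add: abs_if split: if_splits)
    then show ?thesis by (auto simp: normal_density_def)
  qed
  show ?thesis
    unfolding T_def[symmetric]
  proof (rule measure_eqI)
    fix A assume "A \<in> sets (distr (gauss \<sigma>) borel T)"
    then have [measurable]: "A \<in> sets borel" by simp
    let ?f = "\<lambda>x::real^'m. ennreal (\<Prod>i\<in>UNIV. normal_density 0 \<sigma> (x $ i))"
    have "emeasure (gauss \<sigma>) A = (\<integral>\<^sup>+x. ?f x * indicator A x \<partial>lborel)"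
      unfolding gauss_def by (rule emeasure_density) auto
    also have "\<dots> = (\<integral>\<^sup>+x. ?f x * indicator A x \<partial>distr lborel borel T)" by (simp add: lb)
    also have "\<dots> = (\<integral>\<^sup>+x. ?f (T x) * indicator A (T x) \<partial>lborel)"
      by (rule nn_integral_distr) auto
    also have "\<dots> = (\<integral>\<^sup>+x. ?f x * indicator (T -` A) x \<partial>lborel)"
      by (simp add: T_def nd indicator_vimage[of T, symmetric] flip: T_def) (simp add: T_def nd indicator_def)
    also have "\<dots> = emeasure (gauss \<sigma>) (T -` A)"
      using measurable_sets[OF T_meas, of A]
      unfolding gauss_def by (subst emeasure_density) auto
    also have "\<dots> = emeasure (distr (gauss \<sigma>) borel T) A"
      by (subst emeasure_distr) auto
    finally show "emeasure (distr (gauss \<sigma>) borel T) A = emeasure (gauss \<sigma>) A" ..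
  qed simp
qed

lemma distr_gauss_uminus: "distr (gauss \<sigma> :: (real^'m::finite) measure) borel uminus = gauss \<sigma>"
proof -
  have "(\<lambda>x::real^'m. \<chi> i. - 1 * x $ i) = uminus" by (auto simp: vec_eq_iff)
  then show ?thesis using distr_gauss_signs[of "\<lambda>_::'m. - 1" \<sigma>] by simp
qed

lemma gauss_covariance:
  fixes i j :: "'m::finite"
  assumes "0 < \<sigma>"
  shows "integrable (gauss \<sigma>) (\<lambda>x. (x::real^'m) $ i * x $ j)"
    and "(\<integral>x. (x::real^'m) $ i * x $ j \<partial>gauss \<sigma>) = (if i = j then \<sigma>\<^sup>2 else 0)"
proof -
  show int: "integrable (gauss \<sigma>) (\<lambda>x. (x::real^'m) $ i * x $ j)"
  proof (rule Bochner_Integration.integrable_bound)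
    show "integrable (gauss \<sigma>) (\<lambda>x::real^'m. (x $ i) ^ (2 * 1) + (x $ j) ^ (2 * 1))"
      by (intro Bochner_Integration.integrable_add gauss_component_power assms)
    have "\<bar>a * b\<bar> \<le> a ^ (2 * 1) + b ^ (2 * 1)" for a b :: real
    proof -
      have "2 * (\<bar>a\<bar> * \<bar>b\<bar>) \<le> a\<^sup>2 + b\<^sup>2" using sum_squares_bound[of "\<bar>a\<bar>" "\<bar>b\<bar>"] by (simp add: mult.assoc)
      moreover have "0 \<le> \<bar>a\<bar> * \<bar>b\<bar>" by simp
      ultimately show ?thesis unfolding abs_mult mult_1_right by linarith
    qed
    then show "AE x in gauss \<sigma>. norm (x $ i * x $ j) \<le> norm ((x $ i) ^ (2 * 1) + (x $ j) ^ (2 * 1))"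
      by (simp add: abs_of_nonneg)
  qed simp
  show "(\<integral>x. (x::real^'m) $ i * x $ j \<partial>gauss \<sigma>) = (if i = j then \<sigma>\<^sup>2 else 0)"
  proof (cases "i = j")
    case True
    then show ?thesis using gauss_component_power(2)[OF assms, of i 1]
      by (simp add: power2_eq_square)
  next
    case False
    define s where "s k = (if k = i then - 1 else 1 :: real)" for k
    have s: "\<bar>s k\<bar> = 1" for k by (simp add: s_def)
    have "(\<integral>x. (x::real^'m) $ i * x $ j \<partial>gauss \<sigma>)
        = (\<integral>x. (x::real^'m) $ i * x $ j \<partial>distr (gauss \<sigma>) borel (\<lambda>x. \<chi> k. s k * x $ k))"
      by (simp add: distr_gauss_signs[OF s])
    also have "\<dots> = (\<integral>x. (s i * (x::real^'m) $ i) * (s j * x $ j) \<partial>gauss \<sigma>)"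
    proof (subst integral_distr)
      show "(\<lambda>x::real^'m. \<chi> k. s k * x $ k) \<in> gauss \<sigma> \<rightarrow>\<^sub>M borel"
        unfolding measurable_cong_sets[OF sets_gauss refl]
        by (intro borel_measurable_continuous_onI continuous_intros)
    qed simp_all
    also have "\<dots> = - (\<integral>x. (x::real^'m) $ i * x $ j \<partial>gauss \<sigma>)"
      using False by (simp add: s_def)
    finally show ?thesis using False by simp
  qed
qed

lemma norm_matrix_vector_mult_le:
  fixes A :: "real^'m::finite^'d::finite"
  shows "norm (A *v b) \<le> norm A * norm b"
proof -
  have "\<bar>(A *v b) $ i\<bar> \<le> norm (A $ i) * norm b" for i
    using Cauchy_Schwarz_ineq2[of "A $ i" b] by (simp add: matrix_mult_dot)
  then have "norm (A *v b) \<le> L2_set (\<lambda>i. norm (A $ i) * norm b) UNIV"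
    unfolding norm_vec_def[of "A *v b"] by (intro L2_set_mono) auto
  also have "\<dots> = norm A * norm b"
    by (simp add: norm_vec_def[of A] L2_set_left_distrib)
  finally show ?thesis .
qed

lemma gauss_quadratic_form:
  fixes A :: "real^'m::finite^'d::finite" and H :: "'d \<Rightarrow> 'd \<Rightarrow> real"
  assumes "0 < \<sigma>"
  shows "integrable (gauss \<sigma>) (\<lambda>b. \<Sum>i\<in>UNIV. \<Sum>j\<in>UNIV. (A *v b) $ i * (A *v b) $ j * H i j)"
    and "(\<integral>b. (\<Sum>i\<in>UNIV. \<Sum>j\<in>UNIV. (A *v b) $ i * (A *v b) $ j * H i j) \<partial>gauss \<sigma>)
      = \<sigma>\<^sup>2 * (\<Sum>i\<in>UNIV. \<Sum>j\<in>UNIV. (\<Sum>l\<in>UNIV. A $ i $ l * A $ j $ l) * H i j)"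
proof -
  have eq: "(A *v b) $ i * (A *v b) $ j * H i j =
      (\<Sum>l\<in>UNIV. \<Sum>l'\<in>UNIV. (A $ i $ l * A $ j $ l' * H i j) * (b $ l * b $ l'))" for b i j
    unfolding matrix_vector_mult_def vec_lambda_beta sum_product
    unfolding sum_distrib_right
    by (intro sum.cong refl) (simp only: mult_ac)
  show "integrable (gauss \<sigma>) (\<lambda>b. \<Sum>i\<in>UNIV. \<Sum>j\<in>UNIV. (A *v b) $ i * (A *v b) $ j * H i j)"
    unfolding eq by (intro Bochner_Integration.integrable_sum Bochner_Integration.integrable_mult_right gauss_covariance assms)
  have ent: "(\<integral>b. (A *v b) $ i * (A *v b) $ j * H i j \<partial>gauss \<sigma>)
      = \<sigma>\<^sup>2 * ((\<Sum>l\<in>UNIV. A $ i $ l * A $ j $ l) * H i j)" for i j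
  proof -
    have "(\<integral>b. (A *v b) $ i * (A *v b) $ j * H i j \<partial>gauss \<sigma>) =
      (\<Sum>l\<in>UNIV. \<Sum>l'\<in>UNIV. (A $ i $ l * A $ j $ l' * H i j) * (if l = l' then \<sigma>\<^sup>2 else 0))"
      unfolding eq using assms
      by (subst Bochner_Integration.integral_sum, intro Bochner_Integration.integrable_sum Bochner_Integration.integrable_mult_right gauss_covariance)
         (simp_all add: Bochner_Integration.integral_sum gauss_covariance)
    then show ?thesis
      by (simp add: if_distrib[of "\<lambda>x. _ * x"] sum_distrib_left sum_distrib_right mult_ac cong: if_cong)
  qed
  have int: "integrable (gauss \<sigma>) (\<lambda>b. (A *v b) $ i * (A *v b) $ j * H i j)" for i j
    unfolding eq by (intro Bochner_Integration.integrable_sum Bochner_Integration.integrable_mult_right gauss_covariance assms)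
  have "(\<integral>b. (\<Sum>i\<in>UNIV. \<Sum>j\<in>UNIV. (A *v b) $ i * (A *v b) $ j * H i j) \<partial>gauss \<sigma>)
      = (\<Sum>i\<in>UNIV. \<integral>b. (\<Sum>j\<in>UNIV. (A *v b) $ i * (A *v b) $ j * H i j) \<partial>gauss \<sigma>)"
    by (intro Bochner_Integration.integral_sum Bochner_Integration.integrable_sum int)
  also have "\<dots> = (\<Sum>i\<in>UNIV. \<Sum>j\<in>UNIV. \<integral>b. (A *v b) $ i * (A *v b) $ j * H i j \<partial>gauss \<sigma>)"
    by (intro sum.cong refl Bochner_Integration.integral_sum int)
  finally show "(\<integral>b. (\<Sum>i\<in>UNIV. \<Sum>j\<in>UNIV. (A *v b) $ i * (A *v b) $ j * H i j) \<partial>gauss \<sigma>)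
      = \<sigma>\<^sup>2 * (\<Sum>i\<in>UNIV. \<Sum>j\<in>UNIV. (\<Sum>l\<in>UNIV. A $ i $ l * A $ j $ l) * H i j)"
    by (simp only: ent sum_distrib_left)
qed


section \<open>The expected increment over one step\<close>

text \<open>
  Integrates a pointwise bound on symmetric increments. The result is stated with a
  nonnegative real bound \<open>E\<close>, since the right-hand side of the last inequality is a real number
  whose sign cannot be read off, and \<^const>\<open>ennreal\<close> would truncate it.
\<close>

lemma gaussian_increment:
  fixes W :: "real^'d::finite \<Rightarrow> real" and A :: "real^'m::finite^'d" and H :: "'d \<Rightarrow> 'd \<Rightarrow> real"
  assumes [measurable]: "W \<in> borel_measurable borel" and nn: "\<And>y. 0 \<le> W y"
    and \<sigma>: "0 < \<sigma>" and c: "0 \<le> \<beta>" "0 \<le> \<gamma>"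
    and m: "integrable (gauss \<sigma> :: (real^'m) measure) (\<lambda>b. norm b ^ (2 * p))"
      "(\<integral>b. norm b ^ (2 * p) \<partial>(gauss \<sigma> :: (real^'m) measure)) \<le> mp * \<sigma> ^ (2 * p)"
      "integrable (gauss \<sigma> :: (real^'m) measure) (\<lambda>b. norm b ^ (2 * q))"
      "(\<integral>b. norm b ^ (2 * q) \<partial>(gauss \<sigma> :: (real^'m) measure)) \<le> mq * \<sigma> ^ (2 * q)"
    and incr: "\<And>k. W (z + k) + W (z - k) \<le> 2 * a + (\<Sum>i\<in>UNIV. \<Sum>j\<in>UNIV. k $ i * k $ j * H i j)
        + 2 * (\<beta> * norm k ^ (2 * p) + \<gamma> * norm k ^ (2 * q))"
  obtains E where "0 \<le> E" "(\<integral>\<^sup>+b. ennreal (W (z + A *v b)) \<partial>gauss \<sigma>) \<le> ennreal E"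
    "E \<le> a + \<sigma>\<^sup>2 / 2 * (\<Sum>i\<in>UNIV. \<Sum>j\<in>UNIV. (\<Sum>l\<in>UNIV. A $ i $ l * A $ j $ l) * H i j)
      + \<beta> * (mp * (norm A * \<sigma>) ^ (2 * p)) + \<gamma> * (mq * (norm A * \<sigma>) ^ (2 * q))"
proof -
  let ?N = "gauss \<sigma> :: (real^'m) measure"
  interpret prob_space ?N by (rule prob_space_gauss[OF \<sigma>])
  define Q where "Q b = (\<Sum>i\<in>UNIV. \<Sum>j\<in>UNIV. (A *v b) $ i * (A *v b) $ j * H i j)" for b
  define P where "P b = a + (Q b / 2 + (\<beta> * norm A ^ (2 * p) * norm b ^ (2 * p)
      + \<gamma> * norm A ^ (2 * q) * norm b ^ (2 * q)))" for b :: "real^'m"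
  have [measurable]: "(\<lambda>b. A *v b) \<in> borel_measurable borel"
    by (intro borel_measurable_continuous_onI linear_continuous_on matrix_vector_mul_bounded_linear)
  have le: "(W (z + A *v b) + W (z - A *v b)) / 2 \<le> P b" for b
  proof -
    have "norm (A *v b) ^ n \<le> norm A ^ n * norm b ^ n" for n
      unfolding power_mult_distrib[symmetric] by (intro power_mono norm_matrix_vector_mult_le) simp
    then have "\<beta> * norm (A *v b) ^ (2 * p) \<le> \<beta> * (norm A ^ (2 * p) * norm b ^ (2 * p))"
      "\<gamma> * norm (A *v b) ^ (2 * q) \<le> \<gamma> * (norm A ^ (2 * q) * norm b ^ (2 * q))"
      using c by (auto intro!: mult_left_mono)
    then show ?thesis using incr[of "A *v b"] unfolding P_def Q_def by (simp add: mult.assoc)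
  qed
  have P0: "0 \<le> P b" for b
    by (rule order_trans[OF _ le]) (simp add: nn)
  have intQ: "integrable ?N Q" "(\<integral>b. Q b \<partial>?N)
      = \<sigma>\<^sup>2 * (\<Sum>i\<in>UNIV. \<Sum>j\<in>UNIV. (\<Sum>l\<in>UNIV. A $ i $ l * A $ j $ l) * H i j)"
    unfolding Q_def using gauss_quadratic_form[OF \<sigma>] by blast+
  have intP: "integrable ?N P"
    unfolding P_def
    by (intro Bochner_Integration.integrable_add integrable_const Bochner_Integration.integrable_mult_right
        integrable_divide intQ m)
  have "(\<integral>b. P b \<partial>?N) = a + ((\<integral>b. Q b \<partial>?N) / 2 + (\<beta> * norm A ^ (2 * p) * (\<integral>b. norm b ^ (2 * p) \<partial>?N)
      + \<gamma> * norm A ^ (2 * q) * (\<integral>b. norm b ^ (2 * q) \<partial>?N)))"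
    unfolding P_def
    by (simp add: Bochner_Integration.integral_add intQ(1) m(1,3) prob_space[simplified])
  moreover have "\<beta> * norm A ^ (2 * p) * (\<integral>b. norm b ^ (2 * p) \<partial>?N) \<le> \<beta> * norm A ^ (2 * p) * (mp * \<sigma> ^ (2 * p))"
    "\<gamma> * norm A ^ (2 * q) * (\<integral>b. norm b ^ (2 * q) \<partial>?N) \<le> \<gamma> * norm A ^ (2 * q) * (mq * \<sigma> ^ (2 * q))"
    using m c by (auto intro!: mult_left_mono)
  ultimately have E: "(\<integral>b. P b \<partial>?N)
    \<le> a + \<sigma>\<^sup>2 / 2 * (\<Sum>i\<in>UNIV. \<Sum>j\<in>UNIV. (\<Sum>l\<in>UNIV. A $ i $ l * A $ j $ l) * H i j)
      + \<beta> * (mp * (norm A * \<sigma>) ^ (2 * p)) + \<gamma> * (mq * (norm A * \<sigma>) ^ (2 * q))"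
    unfolding intQ(2) power_mult_distrib by (simp add: mult_ac)
  have "(\<integral>\<^sup>+b. ennreal (W (z + A *v b) / 2) \<partial>?N)
      = (\<integral>\<^sup>+b. ennreal (W (z + A *v b) / 2) \<partial>distr ?N borel uminus)"
    by (simp add: distr_gauss_uminus)
  also have "\<dots> = (\<integral>\<^sup>+b. ennreal (W (z - A *v b) / 2) \<partial>?N)"
    by (subst nn_integral_distr) (auto simp: linear_neg[OF matrix_vector_mul_linear])
  finally have sym: "(\<integral>\<^sup>+b. ennreal (W (z + A *v b) / 2) \<partial>?N) = (\<integral>\<^sup>+b. ennreal (W (z - A *v b) / 2) \<partial>?N)" .
  \<comment> \<open>one half of \<open>W\<close> is reflected, the other is kept, which produces the symmetric increment\<close>
  have "(\<integral>\<^sup>+b. ennreal (W (z + A *v b)) \<partial>?N)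
      = (\<integral>\<^sup>+b. ennreal (W (z + A *v b) / 2) + ennreal (W (z + A *v b) / 2) \<partial>?N)"
    by (intro nn_integral_cong) (simp add: nn flip: ennreal_plus)
  also have "\<dots> = (\<integral>\<^sup>+b. ennreal (W (z + A *v b) / 2) \<partial>?N) + (\<integral>\<^sup>+b. ennreal (W (z - A *v b) / 2) \<partial>?N)"
    by (subst nn_integral_add) (auto simp: sym)
  also have "\<dots> = (\<integral>\<^sup>+b. ennreal (W (z + A *v b) / 2) + ennreal (W (z - A *v b) / 2) \<partial>?N)"
    by (rule nn_integral_add[symmetric]) auto
  also have "\<dots> \<le> (\<integral>\<^sup>+b. ennreal (P b) \<partial>?N)"
    using le by (intro nn_integral_mono) (simp add: nn add_divide_distrib ennreal_leI flip: ennreal_plus)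
  also have "\<dots> = ennreal (\<integral>b. P b \<partial>?N)"
    using P0 by (intro nn_integral_eq_integral intP) auto
  finally show ?thesis
    using E P0 by (intro that[of "\<integral>b. P b \<partial>?N"]) (auto intro: integral_nonneg_AE)
qed

lemma partial_V_powr:
  fixes V :: "real^'d::finite \<Rightarrow> real"
  assumes V: "cont_differentiable 2 V" and pos: "\<And>x. x \<noteq> 0 \<Longrightarrow> 0 < V x" and x: "x \<noteq> 0"
  shows "partial i (\<lambda>x. V x powr a) x = a * (V x powr (a - 1) * partial i V x)"
    and "partial i (partial j (\<lambda>x. V x powr a)) x
      = a * ((a - 1) * V x powr (a - 2) * partial i V x * partial j V x + V x powr (a - 1) * partial i (partial j V) x)"
proof -
  have hp: "has_partial k V y" "has_partial k (partial l V) y" for k l y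
    using V by (auto simp: numeral_2_eq_2)
  have 1: "partial k (\<lambda>x. V x powr a) y = a * (V y powr (a - 1) * partial k V y)" if "y \<noteq> 0" for k y
    using has_partial_of_DERIV(2)[OF partial_powr[OF hp(1) pos[OF that]]] .
  then show "partial i (\<lambda>x. V x powr a) x = a * (V x powr (a - 1) * partial i V x)" using x .
  have "partial i (partial j (\<lambda>x. V x powr a)) x = partial i (\<lambda>y. a * (V y powr (a - 1) * partial j V y)) x"
    using 1 x by (intro partial_cong_off_0)
  also have "\<dots> = a * ((a - 1) * V x powr (a - 2) * partial i V x * partial j V x + V x powr (a - 1) * partial i (partial j V) x)"
  proof (rule has_partial_of_DERIV(2))
    have "a - 1 - 1 = a - 2" by simp
    then show "((\<lambda>t. a * (V (x + t *\<^sub>R axis i 1) powr (a - 1) * partial j V (x + t *\<^sub>R axis i 1))) has_real_derivative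
      a * ((a - 1) * V x powr (a - 2) * partial i V x * partial j V x + V x powr (a - 1) * partial i (partial j V) x)) (at 0)"
      using DERIV_cmult[OF DERIV_mult[OF partial_powr[OF hp(1)[of i x] pos[OF x], of "a - 1"]
          has_partialD[OF hp(2)[of i j x]]], of a]
      by (simp add: algebra_simps)
  qed
  finally show "partial i (partial j (\<lambda>x. V x powr a)) x
      = a * ((a - 1) * V x powr (a - 2) * partial i V x * partial j V x + V x powr (a - 1) * partial i (partial j V) x)" .
qed

text \<open>
  Away from the origin \<^const>\<open>gen_powr\<close> is what its name says: the generator of the equation
  applied to \<open>V\<^sup>\<rho>\<close>, here with the trace of \<open>g\<^sup>T D\<^sup>2V\<^sup>\<rho> g\<close> written as it arises from
  the covariance of \<open>g(x) \<xi>\<close>.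
\<close>

lemma gen_powr_eq:
  fixes V :: "real^'d::finite \<Rightarrow> real" and g :: "real^'d \<Rightarrow> real^'m::finite^'d"
  assumes V: "cont_differentiable 2 V" and pos: "\<And>x. x \<noteq> 0 \<Longrightarrow> 0 < V x" and x: "x \<noteq> 0"
  shows "dir_deriv (f x) (\<lambda>x. V x powr \<rho>) x + 1 / 2 * (\<Sum>i\<in>UNIV. \<Sum>j\<in>UNIV.
      (\<Sum>l\<in>UNIV. g x $ i $ l * g x $ j $ l) * partial i (partial j (\<lambda>x. V x powr \<rho>)) x)
    = gen_powr f g V \<rho> x"
proof -
  define G where "G i j = (\<Sum>l\<in>UNIV. g x $ i $ l * g x $ j $ l)" for i j
  have 1: "dir_deriv (f x) (\<lambda>x. V x powr \<rho>) x = \<rho> * V x powr (\<rho> - 1) * (gradient V x \<bullet> f x)"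
    by (simp add: dir_deriv_def partial_V_powr[OF V pos x] gradient_def inner_vec_def sum_distrib_left mult_ac)
  have 2: "(\<Sum>i\<in>UNIV. \<Sum>j\<in>UNIV. G i j * partial i (partial j (\<lambda>x. V x powr \<rho>)) x)
    = \<rho> * (\<rho> - 1) * V x powr (\<rho> - 2) * (\<Sum>i\<in>UNIV. \<Sum>j\<in>UNIV. G i j * (partial i V x * partial j V x))
     + \<rho> * V x powr (\<rho> - 1) * (\<Sum>i\<in>UNIV. \<Sum>j\<in>UNIV. G i j * partial i (partial j V) x)"
    by (simp add: partial_V_powr[OF V pos x] sum_distrib_left sum.distrib[symmetric] algebra_simps)
  have 3: "(\<Sum>i\<in>UNIV. \<Sum>j\<in>UNIV. G i j * (partial i V x * partial j V x)) = (norm (gradient V x v* g x))\<^sup>2"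
  proof -
    have "(norm (gradient V x v* g x))\<^sup>2 = (\<Sum>l\<in>UNIV. (\<Sum>i\<in>UNIV. partial i V x * g x $ i $ l) * (\<Sum>j\<in>UNIV. partial j V x * g x $ j $ l))"
      by (simp add: power2_norm_eq_inner inner_vec_def vector_matrix_mult_def gradient_def)
    also have "\<dots> = (\<Sum>l\<in>UNIV. \<Sum>i\<in>UNIV. \<Sum>j\<in>UNIV. (g x $ i $ l * g x $ j $ l) * (partial i V x * partial j V x))"
      unfolding sum_product by (intro sum.cong refl) (simp only: mult_ac)
    also have "\<dots> = (\<Sum>i\<in>UNIV. \<Sum>l\<in>UNIV. \<Sum>j\<in>UNIV. (g x $ i $ l * g x $ j $ l) * (partial i V x * partial j V x))"
      by (rule sum.swap)
    also have "\<dots> = (\<Sum>i\<in>UNIV. \<Sum>j\<in>UNIV. \<Sum>l\<in>UNIV. (g x $ i $ l * g x $ j $ l) * (partial i V x * partial j V x))"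
      by (intro sum.cong refl sum.swap)
    finally show ?thesis by (simp add: G_def sum_distrib_right)
  qed
  have 4: "(\<Sum>i\<in>UNIV. \<Sum>j\<in>UNIV. G i j * partial i (partial j V) x) = trace (transpose (g x) ** hessian V x ** g x)"
  proof -
    have "trace (transpose (g x) ** hessian V x ** g x)
        = (\<Sum>l\<in>UNIV. \<Sum>j\<in>UNIV. \<Sum>i\<in>UNIV. g x $ i $ l * partial i (partial j V) x * g x $ j $ l)"
      by (simp add: trace_def matrix_matrix_mult_def transpose_def hessian_def sum_distrib_right)
    also have "\<dots> = (\<Sum>l\<in>UNIV. \<Sum>i\<in>UNIV. \<Sum>j\<in>UNIV. g x $ i $ l * partial i (partial j V) x * g x $ j $ l)"
      by (intro sum.cong refl sum.swap)
    also have "\<dots> = (\<Sum>i\<in>UNIV. \<Sum>l\<in>UNIV. \<Sum>j\<in>UNIV. g x $ i $ l * partial i (partial j V) x * g x $ j $ l)"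
      by (rule sum.swap)
    also have "\<dots> = (\<Sum>i\<in>UNIV. \<Sum>j\<in>UNIV. \<Sum>l\<in>UNIV. g x $ i $ l * partial i (partial j V) x * g x $ j $ l)"
      by (intro sum.cong refl sum.swap)
    finally show ?thesis unfolding G_def sum_distrib_right by (simp add: mult_ac)
  qed
  have "V x powr (\<rho> - 1) = V x * V x powr (\<rho> - 2)"
    using pos[OF x] by (simp add: powr_diff power2_eq_square powr_numeral field_simps)
  then show ?thesis
    using x unfolding gen_powr_def gen_def 1 G_def[symmetric] 2 3 4 by (simp add: algebra_simps)
qed

text \<open>
  In terms of the gauge \<open>V\<^sup>\<delta>\<close>, the function \<open>V\<close> itself has order \<open>1/\<delta>\<close>.
\<close>

lemma lyapunov_symbol:
  fixes V :: "real^'d::finite \<Rightarrow> real"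
  assumes V: "V \<in> lyapunov_class p \<delta>" and \<delta>: "0 < \<delta>"
  shows "\<exists>C. symbol (\<lambda>x. V x powr \<delta>) p (1 / \<delta>) C V"
proof -
  have nn: "\<And>x. 0 \<le> V x" and cd: "cont_differentiable p V" and pos: "\<And>x. x \<noteq> 0 \<Longrightarrow> 0 < V x"
    using V by (auto simp: lyapunov_class_def C_inf_def Ker_def less_le)
  obtain c where c: "0 < c" "\<And>n x. n \<in> {1..p} \<Longrightarrow> norm_deriv n V x \<le> c * rpow (V x) (1 - real n * \<delta>)"
    using V by (auto simp: lyapunov_class_def)
  have "\<bar>foldr partial is V x\<bar> \<le> max 1 c * (V x powr \<delta>) powr (1 / \<delta> - real (length is))"
    if "length is \<le> p" "x \<noteq> 0" for "is" x
  proof -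
    have e: "(V x powr \<delta>) powr (1 / \<delta> - real (length is)) = V x powr (1 - real (length is) * \<delta>)"
      using \<delta> by (simp add: powr_powr algebra_simps)
    show ?thesis
    proof (cases "is = []")
      case True
      then show ?thesis using pos[OF that(2)] unfolding e by (simp add: mult_right_mono[of 1, simplified])
    next
      case False
      then have "length is \<in> {1..p}" using that by (cases "is") auto
      moreover have "rpow (V x) (1 - real (length is) * \<delta>) = V x powr (1 - real (length is) * \<delta>)"
        using pos[OF that(2)] by (simp add: rpow_def)
      ultimately have "norm_deriv (length is) V x \<le> c * V x powr (1 - real (length is) * \<delta>)"
        using c(2)[of "length is" x] by simp
      also have "\<dots> \<le> max 1 c * V x powr (1 - real (length is) * \<delta>)" by (intro mult_right_mono) auto
      finally show ?thesis
        unfolding e using abs_foldr_partial_le_norm_deriv[of "is" V x] cont_differentiable_mono[OF cd that(1)]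
        by simp
    qed
  qed
  from symbol_of_cont_differentiable[OF cd this, of "[]" p] show ?thesis by auto
qed

text \<open>
  In the bounds on \<open>f\<close> and \<open>g\<close>, the factor \<open>\<Lambda>\<close> appears to the first power in all the squares.
  It survives in the error estimate because every error term is at least quadratic in \<open>h\<close> or \<open>k\<close> and
  \<open>\<Lambda> \<le> 1\<close>, and there it turns \<open>V\<^sup>\<rho>\<close> into \<open>w\<close>. This is what allows the error to
  be absorbed by the decrease \<open>- \<Delta> w(x)\<close>, which may vanish.
\<close>

lemma one_step:
  fixes V w :: "real^'d::finite \<Rightarrow> real" and f :: "real^'d \<Rightarrow> real^'d"
    and g :: "real^'d \<Rightarrow> real^'m::finite^'d"
  assumes V: "V \<in> lyapunov_class 4 \<delta>" and \<delta>: "0 < \<delta>" and \<rho>: "0 < \<rho>"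
    and w: "\<And>x. 0 \<le> w x" and gen: "\<And>x. gen_powr f g V \<rho> x \<le> - w x"
  obtains c where "0 \<le> c" "\<And>\<Delta> \<tau> x. x \<noteq> 0 \<Longrightarrow> 0 < \<Delta> \<Longrightarrow> 0 \<le> \<tau> \<Longrightarrow> \<tau> \<le> 1 \<Longrightarrow>
      norm (f x) * \<Delta> \<le> \<tau> * (sqrt (Lambda V w \<rho> x) * V x powr \<delta>) \<Longrightarrow>
      (norm (g x))\<^sup>2 * \<Delta> \<le> \<tau> * (Lambda V w \<rho> x * (V x powr \<delta>)\<^sup>2) \<Longrightarrow>
      \<exists>E\<ge>0. (\<integral>\<^sup>+b. ennreal (V (x + \<Delta> *\<^sub>R f x + g x *v b) powr \<rho>) \<partial>gauss (sqrt \<Delta>)) \<le> ennreal E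
        \<and> E \<le> V x powr \<rho> - \<Delta> * w x + c * \<tau>\<^sup>2 * w x"
proof -
  define v where "v = (\<lambda>x. V x powr \<delta>)"
  define W where "W = (\<lambda>x. V x powr \<rho>)"
  have nn: "\<And>x. 0 \<le> V x" and cd: "cont_differentiable 4 V" and pos: "\<And>x. x \<noteq> 0 \<Longrightarrow> 0 < V x"
    and V0: "V 0 = 0"
    using V by (auto simp: lyapunov_class_def C_inf_def Ker_def less_le)
  have cont: "continuous_on UNIV V" using cd by (simp add: numeral_eq_Suc)
  have cd2: "cont_differentiable 2 V" by (rule cont_differentiable_mono[OF cd]) simp
  have vpos: "0 < v x" if "x \<noteq> 0" for x using pos[OF that] by (simp add: v_def)
  have v0: "v 0 = 0" by (simp add: v_def V0)
  have V_v: "V x = v x powr (1 / \<delta>)" for x using \<delta> nn by (simp add: v_def powr_powr)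
  have W_v: "W x = v x powr (\<rho> / \<delta>)" for x using \<delta> by (simp add: W_def v_def powr_powr)
  have cont_powr: "continuous_on UNIV (\<lambda>x. V x powr a)" if "0 < a" for a
    using nn that by (intro continuous_on_powr' cont continuous_intros) auto
  obtain C0 where "symbol v 4 (1 / \<delta>) C0 V" using lyapunov_symbol[OF V \<delta>] unfolding v_def by blast
  from symbol_powr[OF this vpos V_v]
  obtain C1 C2 where C1: "symbol v 4 (\<delta> * (1 / \<delta>)) C1 v" and C2: "symbol v 4 (\<rho> * (1 / \<delta>)) C2 W"
    unfolding v_def W_def by metis
  have symv: "symbol v 1 1 (max 0 C1) v"
    using symbol_mono[OF symbol_le[OF C1, of 1], of "max 0 C1"] \<delta> by simp
  define C where "C = max 0 C2"
  have symW: "symbol v 4 (\<rho> / \<delta>) C W"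
    using symbol_mono[OF C2, of C] by (simp add: C_def del: symbol.simps)
  define L where "L = max 1 (real CARD('d) * max 0 C1)"
  have lip: "\<bar>v y - v x\<bar> \<le> L * norm (y - x)" for x y
  proof -
    have "\<bar>v y - v x\<bar> \<le> real CARD('d) * max 0 C1 * norm (y - x)"
      using cont_powr[OF \<delta>] by (intro gauge_lipschitz symv vpos) (auto simp: v_def)
    also have "\<dots> \<le> L * norm (y - x)" by (intro mult_right_mono) (auto simp: L_def)
    finally show ?thesis .
  qed
  \<comment> \<open>\<open>2p\<close> must dominate the growth exponent \<open>\<rho>/\<delta>\<close> of \<open>W\<close> in the gauge, and \<open>p \<ge> 2\<close> makes the error quadratic in \<open>\<tau>\<close>\<close>
  define p where "p = max 2 (nat \<lceil>\<rho> / \<delta>\<rceil>)"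
  have "\<rho> / \<delta> \<le> real (2 * p)"
    using of_nat_ceiling[of "\<rho> / \<delta>"] by (simp add: p_def max_def)
  moreover have p2: "2 \<le> p" by (simp add: p_def)
  ultimately obtain c0 where c0: "0 \<le> c0" "\<And>x h k. x \<noteq> 0 \<Longrightarrow> norm h \<le> v x \<Longrightarrow>
    W (x + h + k) + W (x + h - k) \<le> 2 * W x + 2 * dir_deriv h W x + (dir_deriv k ^^ 2) W x
      + c0 * (W x * ((norm h / v x)\<^sup>2 + (norm k / v x) ^ 4 + (norm k / v x) ^ (2 * p)))"
    using symmetric_increment[OF symW _ W_v _ _ _ v0 vpos lip, of "2 * p"] \<rho> \<delta>
    by (auto simp: C_def L_def)
  obtain m2 where m2: "0 \<le> m2" "\<And>\<sigma>. 0 < \<sigma> \<Longrightarrow> integrable (gauss \<sigma> :: (real^'m) measure) (\<lambda>x. norm x ^ (2 * 2))"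
    "\<And>\<sigma>. 0 < \<sigma> \<Longrightarrow> (\<integral>x. norm x ^ (2 * 2) \<partial>(gauss \<sigma> :: (real^'m) measure)) \<le> m2 * \<sigma> ^ (2 * 2)"
    using gauss_norm_moment by metis
  obtain mp where mp: "0 \<le> mp" "\<And>\<sigma>. 0 < \<sigma> \<Longrightarrow> integrable (gauss \<sigma> :: (real^'m) measure) (\<lambda>x. norm x ^ (2 * p))"
    "\<And>\<sigma>. 0 < \<sigma> \<Longrightarrow> (\<integral>x. norm x ^ (2 * p) \<partial>(gauss \<sigma> :: (real^'m) measure)) \<le> mp * \<sigma> ^ (2 * p)"
    using gauss_norm_moment by metis
  define c where "c = c0 / 2 * (1 + m2 + mp)"
  show ?thesis
  proof (rule that[of c])
    show "0 \<le> c" using c0 m2 mp by (simp add: c_def)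
    fix \<Delta> \<tau> :: real and x :: "real^'d"
    assume x: "x \<noteq> 0" and \<Delta>: "0 < \<Delta>" and \<tau>: "0 \<le> \<tau>" "\<tau> \<le> 1"
      and fx: "norm (f x) * \<Delta> \<le> \<tau> * (sqrt (Lambda V w \<rho> x) * V x powr \<delta>)"
      and gx: "(norm (g x))\<^sup>2 * \<Delta> \<le> \<tau> * (Lambda V w \<rho> x * (V x powr \<delta>)\<^sup>2)"
    define l where "l = Lambda V w \<rho> x"
    define u where "u = v x"
    define h where "h = \<Delta> *\<^sub>R f x"
    have u: "0 < u" using vpos[OF x] by (simp add: u_def)
    have Wx: "0 < W x" using pos[OF x] by (simp add: W_def)
    have l: "0 \<le> l" "l \<le> 1" using w by (auto simp: l_def Lambda_def)
    have lW: "l * W x \<le> w x"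
    proof -
      have "l * W x \<le> w x / W x * W x" using Wx by (intro mult_right_mono) (auto simp: l_def Lambda_def W_def)
      then show ?thesis using Wx by simp
    qed
    have h1: "norm h / u \<le> \<tau> * sqrt l"
      using fx u \<Delta> by (simp add: h_def l_def u_def v_def field_simps)
    have "\<tau> * sqrt l \<le> 1" using \<tau> l by (intro mult_le_one) auto
    with h1 have "norm h / u \<le> 1" by linarith
    then have hv: "norm h \<le> v x" using u by (simp add: u_def)
    have "(norm h / u)\<^sup>2 \<le> (\<tau> * sqrt l)\<^sup>2" using h1 u by (intro power_mono) auto
    then have h2: "(norm h / u)\<^sup>2 \<le> l * \<tau>\<^sup>2" using l by (simp add: power_mult_distrib mult.commute)
    \<comment> \<open>the mean square of \<open>|k|/u\<close> is at most a multiple of \<open>y\<close>\<close>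
    define y where "y = (norm (g x))\<^sup>2 * \<Delta> / u\<^sup>2"
    have y: "0 \<le> y" "y \<le> l * \<tau>"
      using gx u \<Delta> by (auto simp: y_def l_def u_def v_def field_simps)
    have yp: "y ^ n \<le> l * \<tau>\<^sup>2" if "2 \<le> n" for n
    proof -
      have "y ^ n \<le> (l * \<tau>) ^ n" using y by (intro power_mono)
      also have "\<dots> = l ^ n * \<tau> ^ n" by (rule power_mult_distrib)
      also have "\<dots> \<le> l ^ 1 * \<tau>\<^sup>2" using l \<tau> that by (intro mult_mono power_decreasing) auto
      finally show ?thesis by simp
    qed
    have norm_y: "(norm (g x) * sqrt \<Delta>) ^ (2 * n) / u ^ (2 * n) = y ^ n" for n
      using \<Delta> by (simp add: y_def power_mult power_mult_distrib power_divide)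
    define \<beta> where "\<beta> = c0 / 2 * W x / u ^ (2 * 2)"
    define \<gamma> where "\<gamma> = c0 / 2 * W x / u ^ (2 * p)"
    define H where "H i j = partial i (partial j W) x" for i j
    define a where "a = W x + dir_deriv h W x + c0 / 2 * (W x * (norm h / u)\<^sup>2)"
    have bc: "0 \<le> \<beta>" "0 \<le> \<gamma>" using c0 Wx u by (auto simp: \<beta>_def \<gamma>_def)
    have incr: "W (x + h + k) + W (x + h - k) \<le> 2 * a + (\<Sum>i\<in>UNIV. \<Sum>j\<in>UNIV. k $ i * k $ j * H i j)
        + 2 * (\<beta> * norm k ^ (2 * 2) + \<gamma> * norm k ^ (2 * p))" for k
    proof -
      have "(dir_deriv k ^^ 2) W x = (\<Sum>i\<in>UNIV. \<Sum>j\<in>UNIV. k $ i * k $ j * H i j)"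
        unfolding H_def by (rule dir_deriv_pow_2[OF symbol_le[OF symW] x]) simp
      then show ?thesis
        using c0(2)[OF x hv, of k]
        by (simp add: a_def \<beta>_def \<gamma>_def power_divide u_def[symmetric] algebra_simps)
    qed
    have sq: "0 < sqrt \<Delta>" using \<Delta> by simp
    have W_nn: "\<And>y. 0 \<le> W y" by (simp add: W_def)
    have W_meas: "W \<in> borel_measurable borel"
      unfolding W_def by (intro borel_measurable_continuous_onI cont_powr \<rho>)
    obtain E where E: "0 \<le> E" "(\<integral>\<^sup>+b. ennreal (W (x + h + g x *v b)) \<partial>gauss (sqrt \<Delta>)) \<le> ennreal E"
      "E \<le> a + (sqrt \<Delta>)\<^sup>2 / 2 * (\<Sum>i\<in>UNIV. \<Sum>j\<in>UNIV. (\<Sum>k\<in>UNIV. g x $ i $ k * g x $ j $ k) * H i j)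
      + \<beta> * (m2 * (norm (g x) * sqrt \<Delta>) ^ (2 * 2)) + \<gamma> * (mp * (norm (g x) * sqrt \<Delta>) ^ (2 * p))"
      by (rule gaussian_increment[OF W_meas W_nn sq bc m2(2,3)[OF sq] mp(2,3)[OF sq] incr])
    have dd: "dir_deriv h W x = \<Delta> * dir_deriv (f x) W x"
      by (simp add: h_def dir_deriv_def sum_distrib_left mult.assoc)
    have ge: "dir_deriv (f x) W x
        + 1 / 2 * (\<Sum>i\<in>UNIV. \<Sum>j\<in>UNIV. (\<Sum>k\<in>UNIV. g x $ i $ k * g x $ j $ k) * H i j)
      = gen_powr f g V \<rho> x"
      unfolding W_def H_def by (rule gen_powr_eq[OF cd2 pos x])
    have e1: "a + (sqrt \<Delta>)\<^sup>2 / 2 * (\<Sum>i\<in>UNIV. \<Sum>j\<in>UNIV. (\<Sum>k\<in>UNIV. g x $ i $ k * g x $ j $ k) * H i j)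
      = W x + \<Delta> * gen_powr f g V \<rho> x + c0 / 2 * (W x * (norm h / u)\<^sup>2)"
      unfolding a_def dd ge[symmetric] using \<Delta> by (simp add: algebra_simps)
    have e2: "\<beta> * (m2 * (norm (g x) * sqrt \<Delta>) ^ (2 * 2)) = c0 / 2 * (W x * (m2 * y ^ 2))"
      unfolding norm_y[symmetric] \<beta>_def by simp
    have e3: "\<gamma> * (mp * (norm (g x) * sqrt \<Delta>) ^ (2 * p)) = c0 / 2 * (W x * (mp * y ^ p))"
      unfolding norm_y[symmetric] \<gamma>_def by simp
    have "E \<le> W x + \<Delta> * gen_powr f g V \<rho> x
        + c0 / 2 * (W x * ((norm h / u)\<^sup>2 + m2 * y ^ 2 + mp * y ^ p))"
      using E(3) unfolding e1 e2 e3 by (simp only: distrib_left add.assoc)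
    also have "\<dots> \<le> W x + \<Delta> * (- w x) + c0 / 2 * (W x * (l * \<tau>\<^sup>2 + m2 * (l * \<tau>\<^sup>2) + mp * (l * \<tau>\<^sup>2)))"
      using \<Delta> c0(1) Wx gen[of x] h2 yp[of 2] yp[OF p2] m2(1) mp(1)
      by (intro add_mono mult_left_mono order_refl) auto
    also have "\<dots> = W x - \<Delta> * w x + c * \<tau>\<^sup>2 * (l * W x)"
      by (simp add: c_def algebra_simps)
    also have "\<dots> \<le> W x - \<Delta> * w x + c * \<tau>\<^sup>2 * w x"
      using \<open>0 \<le> c\<close> lW by (intro add_left_mono mult_left_mono) auto
    finally show "\<exists>E\<ge>0. (\<integral>\<^sup>+b. ennreal (V (x + \<Delta> *\<^sub>R f x + g x *v b) powr \<rho>) \<partial>gauss (sqrt \<Delta>)) \<le> ennreal E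
        \<and> E \<le> V x powr \<rho> - \<Delta> * w x + c * \<tau>\<^sup>2 * w x"
      using E(1,2) by (auto simp: W_def h_def intro!: exI[of _ E])
  qed
qed


section \<open>The truncated scheme\<close>

text \<open>
  Conditioning on \<open>F s\<close>: the state at time \<open>s\<close> and the increment are independent, so their
  joint law is a product and the increment can be integrated out first.
\<close>

lemma nn_integral_brownian_increment:
  fixes X :: "'a \<Rightarrow> real^'d::finite" and B :: "real \<Rightarrow> 'a \<Rightarrow> real^'m::finite"
  assumes "prob_space M" and B: "brownian_motion M F B" and st: "0 \<le> s" "s < t"
    and sub: "subalgebra M (F s)" and X: "X \<in> borel_measurable (F s)"
    and \<Phi>[measurable]: "\<Phi> \<in> borel_measurable (borel \<Otimes>\<^sub>M borel)"
  shows "(\<integral>\<^sup>+\<omega>. \<Phi> (X \<omega>, B t \<omega> - B s \<omega>) \<partial>M) = (\<integral>\<^sup>+\<omega>. \<integral>\<^sup>+b. \<Phi> (X \<omega>, b) \<partial>gauss (sqrt (t - s)) \<partial>M)"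
proof -
  interpret prob_space M by fact
  define Y where "Y = (\<lambda>\<omega>. B t \<omega> - B s \<omega>)"
  have ind: "indep_set (sets (F s)) {Y -` A \<inter> space M | A. A \<in> sets borel}"
    and dist: "distributed M lborel Y (\<lambda>x. ennreal (\<Prod>i\<in>UNIV. normal_density 0 (sqrt (t - s)) (x $ i)))"
    using B st unfolding brownian_motion_def Y_def by blast+
  have XM [measurable]: "X \<in> borel_measurable M" by (rule measurable_from_subalg[OF sub X])
  have YM [measurable]: "Y \<in> borel_measurable M" using distributed_measurable[OF dist] by simp
  have dY: "distr M borel Y = gauss (sqrt (t - s))"
    using distributed_distr_eq_density[OF dist] unfolding gauss_def
    by (metis distr_cong sets_lborel)
  have spF: "space (F s) = space M" using sub by (simp add: subalgebra_def)
  interpret G: prob_space "gauss (sqrt (t - s)) :: (real^'m) measure"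
    by (rule prob_space_gauss) (use st in simp)
  interpret dX: prob_space "distr M borel X" by (rule prob_space_distr) simp
  have joint: "distr M borel X \<Otimes>\<^sub>M gauss (sqrt (t - s)) = distr M (borel \<Otimes>\<^sub>M borel) (\<lambda>\<omega>. (X \<omega>, Y \<omega>))"
  proof (rule pair_measure_eqI)
    show "sets (distr M borel X \<Otimes>\<^sub>M gauss (sqrt (t - s)))
        = sets (distr M (borel \<Otimes>\<^sub>M borel) (\<lambda>\<omega>. (X \<omega>, Y \<omega>)))"
      by (simp cong: sets_pair_measure_cong)
    fix A C assume "A \<in> sets (distr M borel X)" "C \<in> sets (gauss (sqrt (t - s)) :: (real^'m) measure)"
    then have [measurable]: "A \<in> sets borel" "C \<in> sets borel" by simp_all
    have "X -` A \<inter> space M \<in> sets (F s)" using measurable_sets[OF X, of A] spF by simp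
    then have *: "prob ((X -` A \<inter> space M) \<inter> (Y -` C \<inter> space M)) = prob (X -` A \<inter> space M) * prob (Y -` C \<inter> space M)"
      by (intro indep_setD[OF ind]) auto
    have "emeasure (distr M borel X) A * emeasure (distr M borel Y) C
        = ennreal (prob (X -` A \<inter> space M) * prob (Y -` C \<inter> space M))"
      by (simp add: emeasure_distr emeasure_eq_measure ennreal_mult)
    also have "\<dots> = emeasure M ((\<lambda>\<omega>. (X \<omega>, Y \<omega>)) -` (A \<times> C) \<inter> space M)"
      unfolding *[symmetric] emeasure_eq_measure by (rule arg_cong[where f="\<lambda>S. ennreal (prob S)"]) auto
    also have "\<dots> = emeasure (distr M (borel \<Otimes>\<^sub>M borel) (\<lambda>\<omega>. (X \<omega>, Y \<omega>))) (A \<times> C)"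
      by (rule emeasure_distr[symmetric]) auto
    finally show "emeasure (distr M borel X) A * emeasure (gauss (sqrt (t - s))) C
        = emeasure (distr M (borel \<Otimes>\<^sub>M borel) (\<lambda>\<omega>. (X \<omega>, Y \<omega>))) (A \<times> C)"
      by (simp add: dY)
  qed unfold_locales
  have "(\<integral>\<^sup>+\<omega>. \<Phi> (X \<omega>, Y \<omega>) \<partial>M) = (\<integral>\<^sup>+z. \<Phi> z \<partial>distr M (borel \<Otimes>\<^sub>M borel) (\<lambda>\<omega>. (X \<omega>, Y \<omega>)))"
    by (subst nn_integral_distr) auto
  also have "\<dots> = (\<integral>\<^sup>+x. \<integral>\<^sup>+b. \<Phi> (x, b) \<partial>gauss (sqrt (t - s)) \<partial>distr M borel X)"
    unfolding joint[symmetric]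
    by (rule G.nn_integral_fst[symmetric]) (simp add: measurable_cong_sets[OF sets_pair_measure_cong[OF sets_distr sets_gauss] refl])
  also have "\<dots> = (\<integral>\<^sup>+\<omega>. \<integral>\<^sup>+b. \<Phi> (X \<omega>, b) \<partial>gauss (sqrt (t - s)) \<partial>M)"
    by (subst nn_integral_distr) auto
  finally show ?thesis by (simp add: Y_def)
qed

text \<open>
  By the intermediate value theorem \<open>\<kappa>\<close> is a value of \<open>\<phi>\<close>; otherwise \<^const>\<open>the_inv_into\<close> would
  be unspecified there.
\<close>

lemma the_inv_into_above:
  fixes \<phi> :: "real \<Rightarrow> real"
  assumes "strict_mono_on {0<..} \<phi>" "continuous_on {0<..} \<phi>" "filterlim \<phi> at_top at_top"
    and "0 < r" "\<phi> r \<le> \<kappa>"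
  shows "r \<le> the_inv_into {0<..} \<phi> \<kappa>" "\<phi> (the_inv_into {0<..} \<phi> \<kappa>) = \<kappa>"
proof -
  have "eventually (\<lambda>x. \<kappa> \<le> \<phi> x) at_top" using assms(3) by (simp add: filterlim_at_top)
  then obtain b where b: "r \<le> b" "\<kappa> \<le> \<phi> b"
    by (metis eventually_at_top_linorder linorder_linear order_refl)
  have "continuous_on {r..b} \<phi>" using assms(4) by (intro continuous_on_subset[OF assms(2)]) auto
  from IVT'[OF assms(5) b(2,1) this] obtain R where R: "r \<le> R" "\<phi> R = \<kappa>" by blast
  have "inj_on \<phi> {0<..}" using assms(1) by (rule strict_mono_on_imp_inj_on)
  then have "the_inv_into {0<..} \<phi> \<kappa> = R"
    using R assms(4) the_inv_into_f_f[of \<phi> "{0<..}" R] by simp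
  then show "r \<le> the_inv_into {0<..} \<phi> \<kappa>" "\<phi> (the_inv_into {0<..} \<phi> \<kappa>) = \<kappa>" using R by auto
qed

text \<open>
  For \<open>d = 0\<close> this relies on \<open>a / 0 = \<infinity>\<close>, which leaves only \<open>a = 0\<close>.
\<close>

lemma ennreal_divide_le_imp_le_mult:
  assumes "ennreal a / ennreal d \<le> ennreal k" "0 \<le> a" "0 \<le> d" "0 \<le> k"
  shows "a \<le> k * d"
proof (cases "d = 0")
  case True
  have "\<not> 0 < a"
  proof
    assume "0 < a"
    with True assms(1) have "\<infinity> \<le> ennreal k" by (simp add: ennreal_quotient_conventions(2))
    then show False by (simp add: top_unique)
  qed
  with assms(2) True show ?thesis by simp
next
  case False
  then show ?thesis using assms by (simp add: divide_ennreal pos_divide_le_eq)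
qed

text \<open>
  In product form the bounds include the points where \<open>\<Lambda>\<close> vanishes: there they say that \<open>f\<close> and
  \<open>g\<close> vanish too, so that the scheme stands still.
\<close>

lemma scheme_sup_bounds:
  assumes sup: "scheme_sup f g V w \<rho> \<delta> u \<le> ennreal \<kappa>" and "0 \<le> \<kappa>"
    and x: "x \<noteq> 0" "norm x \<le> u" and w: "0 \<le> w x"
  shows "norm (f x) \<le> \<kappa> * (sqrt (Lambda V w \<rho> x) * V x powr \<delta>)"
    and "(norm (g x))\<^sup>2 \<le> \<kappa> * (Lambda V w \<rho> x * (V x powr \<delta>)\<^sup>2)"
proof -
  have l: "0 \<le> Lambda V w \<rho> x" using w by (simp add: Lambda_def)
  have "max (ennreal (norm (f x)) / ennreal (Lambda V w \<rho> x powr (1 / 2) * V x powr \<delta>))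
         (ennreal ((norm (g x))\<^sup>2) / ennreal (Lambda V w \<rho> x * V x powr (2 * \<delta>))) \<le> scheme_sup f g V w \<rho> \<delta> u"
    unfolding scheme_sup_def by (rule SUP_upper) (use x in simp)
  with sup have *: "ennreal (norm (f x)) / ennreal (Lambda V w \<rho> x powr (1 / 2) * V x powr \<delta>) \<le> ennreal \<kappa>"
    "ennreal ((norm (g x))\<^sup>2) / ennreal (Lambda V w \<rho> x * V x powr (2 * \<delta>)) \<le> ennreal \<kappa>"
    by (auto intro: order_trans)
  show "norm (f x) \<le> \<kappa> * (sqrt (Lambda V w \<rho> x) * V x powr \<delta>)"
    using ennreal_divide_le_imp_le_mult[OF *(1)] l \<open>0 \<le> \<kappa>\<close> by (simp add: powr_half_sqrt)
  have "V x powr (2 * \<delta>) = (V x powr \<delta>)\<^sup>2"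
    by (simp add: power2_eq_square flip: powr_add)
  then show "(norm (g x))\<^sup>2 \<le> \<kappa> * (Lambda V w \<rho> x * (V x powr \<delta>)\<^sup>2)"
    using ennreal_divide_le_imp_le_mult[OF *(2)] l \<open>0 \<le> \<kappa>\<close> by simp
qed

lemma trunc_map_scales:
  assumes "0 < the_inv_into {0<..} \<phi> (K * \<Delta> powr (- \<theta>))"
  obtains \<epsilon> where "0 < \<epsilon>" "\<epsilon> \<le> 1" "trunc_map \<phi> K \<theta> \<Delta> x = \<epsilon> *\<^sub>R x"
proof (cases "x = 0")
  case True
  then show ?thesis by (intro that[of 1]) (auto simp: trunc_map_def)
next
  case False
  show ?thesis
    by (rule that[of "min (norm x) (the_inv_into {0<..} \<phi> (K * \<Delta> powr (- \<theta>))) / norm x"])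
       (use False assms in \<open>simp_all add: trunc_map_def sgn_div_norm pos_divide_le_eq, simp add: divide_inverse\<close>)
qed

lemma norm_trunc_map_le:
  assumes "0 \<le> the_inv_into {0<..} \<phi> (K * \<Delta> powr (- \<theta>))"
  shows "norm (trunc_map \<phi> K \<theta> \<Delta> x) \<le> the_inv_into {0<..} \<phi> (K * \<Delta> powr (- \<theta>))"
  using assms by (auto simp: trunc_map_def norm_sgn)

text \<open>
  On the compact set of points in the ball at distance at least \<open>e\<close> from the zeros, \<open>w\<close> is
  bounded away from 0, so that set is eventually avoided.
\<close>

lemma infdist_zero_set_tendsto:
  fixes w :: "'b::euclidean_space \<Rightarrow> real"
  assumes cont: "continuous_on UNIV w" and nn: "\<And>x. 0 \<le> w x"
    and bnd: "\<And>k. norm (z k) \<le> R" and lim: "(\<lambda>k. w (z k)) \<longlonglongrightarrow> 0"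
  shows "(\<lambda>k. infdist (z k) {x. w x = 0}) \<longlonglongrightarrow> 0"
proof (rule LIMSEQ_I)
  fix e :: real assume "0 < e"
  define S where "S = cball 0 R \<inter> {x. e \<le> infdist x {x. w x = 0}}"
  have "closed {x. e \<le> infdist x {x. w x = 0}}"
    by (intro closed_Collect_le continuous_intros)
  then have S: "compact S" unfolding S_def by (intro compact_Int_closed) auto
  have "\<exists>m>0. \<forall>x\<in>S. m \<le> w x"
  proof (cases "S = {}")
    case True
    then show ?thesis by (auto intro: exI[of _ 1])
  next
    case False
    obtain y where y: "y \<in> S" "\<forall>x\<in>S. w y \<le> w x"
      using continuous_attains_inf[OF S False continuous_on_subset[OF cont]] by auto
    have "w y \<noteq> 0"
    proof
      assume "w y = 0"
      then have "infdist y {x. w x = 0} = 0" by (intro infdist_zero) simp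
      with y(1) \<open>0 < e\<close> show False by (simp add: S_def)
    qed
    with nn[of y] y show ?thesis by (intro exI[of _ "w y"]) auto
  qed
  then obtain m where m: "0 < m" "\<And>x. x \<in> S \<Longrightarrow> m \<le> w x" by blast
  obtain n where n: "\<And>k. n \<le> k \<Longrightarrow> w (z k) < m"
    using order_tendstoD(2)[OF lim m(1)] by (auto simp: eventually_sequentially)
  have "norm (infdist (z k) {x. w x = 0} - 0) < e" if "n \<le> k" for k
  proof -
    have "z k \<notin> S" using n[OF that] m(2)[of "z k"] by auto
    then show ?thesis using bnd[of k] by (auto simp: S_def infdist_nonneg)
  qed
  then show "\<exists>n. \<forall>k\<ge>n. norm (infdist (z k) {x. w x = 0} - 0) < e" by blast
qed

text \<open>
  The expectations of the \<open>b k\<close> telescope against those of the \<open>a k\<close>, so \<open>\<Sum>\<^sub>k b k\<close> has a finite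
  expectation and is finite almost surely.
\<close>

lemma AE_tendsto_0_of_drift:
  assumes "prob_space M"
    and [measurable]: "\<And>k. a k \<in> borel_measurable M" "\<And>k. b k \<in> borel_measurable M"
    and nn: "\<And>k \<omega>. 0 \<le> b k \<omega>"
    and drift: "\<And>k. (\<integral>\<^sup>+\<omega>. a (Suc k) \<omega> \<partial>M) + (\<integral>\<^sup>+\<omega>. ennreal (b k \<omega>) \<partial>M) \<le> (\<integral>\<^sup>+\<omega>. a k \<omega> \<partial>M)"
    and fin: "(\<integral>\<^sup>+\<omega>. a 0 \<omega> \<partial>M) < \<infinity>"
  shows "AE \<omega> in M. (\<lambda>k. b k \<omega>) \<longlonglongrightarrow> 0"
proof -
  have le: "(\<integral>\<^sup>+\<omega>. a n \<omega> \<partial>M) + (\<Sum>k<n. \<integral>\<^sup>+\<omega>. ennreal (b k \<omega>) \<partial>M) \<le> (\<integral>\<^sup>+\<omega>. a 0 \<omega> \<partial>M)" for n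
  proof (induction n)
    case (Suc n)
    have "(\<integral>\<^sup>+\<omega>. a (Suc n) \<omega> \<partial>M) + (\<Sum>k<Suc n. \<integral>\<^sup>+\<omega>. ennreal (b k \<omega>) \<partial>M)
      = ((\<integral>\<^sup>+\<omega>. a (Suc n) \<omega> \<partial>M) + (\<integral>\<^sup>+\<omega>. ennreal (b n \<omega>) \<partial>M)) + (\<Sum>k<n. \<integral>\<^sup>+\<omega>. ennreal (b k \<omega>) \<partial>M)"
      by (simp add: add_ac)
    also have "\<dots> \<le> (\<integral>\<^sup>+\<omega>. a n \<omega> \<partial>M) + (\<Sum>k<n. \<integral>\<^sup>+\<omega>. ennreal (b k \<omega>) \<partial>M)"
      by (intro add_right_mono drift)
    finally show ?case using Suc.IH by (rule order_trans)
  qed simp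
  have "(\<integral>\<^sup>+\<omega>. (\<Sum>k. ennreal (b k \<omega>)) \<partial>M) = (\<Sum>k. \<integral>\<^sup>+\<omega>. ennreal (b k \<omega>) \<partial>M)"
    by (rule nn_integral_suminf) simp
  also have "\<dots> \<le> (\<integral>\<^sup>+\<omega>. a 0 \<omega> \<partial>M)"
  proof (intro suminf_le_const summableI)
    show "(\<Sum>k<n. \<integral>\<^sup>+\<omega>. ennreal (b k \<omega>) \<partial>M) \<le> (\<integral>\<^sup>+\<omega>. a 0 \<omega> \<partial>M)" for n
      by (rule order_trans[OF _ le[of n]]) simp
  qed
  finally have "(\<integral>\<^sup>+\<omega>. (\<Sum>k. ennreal (b k \<omega>)) \<partial>M) \<noteq> \<infinity>" using fin by auto
  then have "AE \<omega> in M. (\<Sum>k. ennreal (b k \<omega>)) \<noteq> \<infinity>"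
    by (intro nn_integral_PInf_AE) auto
  then show ?thesis
    by eventually_elim (use nn in \<open>auto intro!: summable_LIMSEQ_zero summable_suminf_not_top\<close>)
qed

lemma euler_step_measurable:
  fixes f :: "real^'d::finite \<Rightarrow> real^'d" and g :: "real^'d \<Rightarrow> real^'m::finite^'d"
  assumes f: "continuous_on UNIV f" and g: "continuous_on UNIV g"
  shows "(\<lambda>z. trunc_map \<phi> K \<theta> \<Delta> (fst z + \<Delta> *\<^sub>R f (fst z) + g (fst z) *v snd z))
    \<in> borel_measurable (borel \<Otimes>\<^sub>M borel)"
proof -
  have "continuous_on UNIV (\<lambda>z. fst z + \<Delta> *\<^sub>R f (fst z) + g (fst z) *v (snd z :: real^'m))"
    unfolding matrix_vector_mult_def
    by (intro continuous_intros continuous_on_compose2[OF f] continuous_on_compose2[OF g]) auto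
  then have [measurable]: "(\<lambda>z. fst z + \<Delta> *\<^sub>R f (fst z) + g (fst z) *v (snd z :: real^'m))
      \<in> borel_measurable (borel \<Otimes>\<^sub>M borel)"
    unfolding borel_prod by (rule borel_measurable_continuous_onI)
  show ?thesis unfolding trunc_map_def sgn_div_norm by measurable
qed

lemma truncated_EM_adapted:
  fixes f :: "real^'d::finite \<Rightarrow> real^'d" and g :: "real^'d \<Rightarrow> real^'m::finite^'d"
  assumes "usual_stochastic_basis M F" and B: "brownian_motion M F B"
    and f: "continuous_on UNIV f" and g: "continuous_on UNIV g" and "0 < \<Delta>"
  shows "truncated_EM f g B \<phi> K \<theta> x0 \<Delta> k \<in> borel_measurable (F (real k * \<Delta>))"
proof (induction k)
  case (Suc k)
  interpret usual_stochastic_basis M F by fact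
  define s t where "s = real k * \<Delta>" and "t = real (Suc k) * \<Delta>"
  have st: "0 \<le> s" "s \<le> t" using \<open>0 < \<Delta>\<close> by (auto simp: s_def t_def)
  have "subalgebra (F t) (F s)"
    using subalg[of s] subalg[of t] mono[of s t] st by (auto simp: subalgebra_def)
  moreover have "B s \<in> borel_measurable (F s)" "B t \<in> borel_measurable (F t)"
    using B st by (auto simp: brownian_motion_def)
  ultimately have [measurable]: "B s \<in> borel_measurable (F t)" "B t \<in> borel_measurable (F t)"
    "truncated_EM f g B \<phi> K \<theta> x0 \<Delta> k \<in> borel_measurable (F t)"
    using Suc.IH by (auto simp: s_def intro: measurable_from_subalg)
  have "(\<lambda>\<omega>. (\<lambda>z. trunc_map \<phi> K \<theta> \<Delta> (fst z + \<Delta> *\<^sub>R f (fst z) + g (fst z) *v snd z))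
      (truncated_EM f g B \<phi> K \<theta> x0 \<Delta> k \<omega>, B t \<omega> - B s \<omega>)) \<in> borel_measurable (F t)"
    by (rule measurable_compose[OF _ euler_step_measurable[OF f g]]) measurable
  then show ?case by (simp add: s_def t_def Let_def)
qed simp

theorem theorem5p6:
  fixes M :: "'a measure" and F :: "real \<Rightarrow> 'a measure"
    and B :: "real \<Rightarrow> 'a \<Rightarrow> real^'m::finite"
    and f :: "real^'d::finite \<Rightarrow> real^'d" and g :: "real^'d \<Rightarrow> real^'m^'d"
    and x0 :: "real^'d"
    and V w :: "real^'d \<Rightarrow> real"
    and \<rho> \<delta> :: real
    and \<phi> :: "real \<Rightarrow> real" and \<theta> \<Delta>s K :: real
  assumes "usual_stochastic_basis M F"
    and "brownian_motion M F B"
    and "local_lipschitz (UNIV :: real set) UNIV (\<lambda>_. f)" and "f 0 = 0"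
    and "local_lipschitz (UNIV :: real set) UNIV (\<lambda>_. g)" and "g 0 = 0"
    and "\<rho> > 0"
    and "1 / \<delta> \<in> \<nat>" and "1 / \<delta> \<ge> 4"
    and "V \<in> lyapunov_class 4 \<delta>"
    and "continuous_on UNIV w" and "\<forall>x. 0 \<le> w x"
    and "\<forall>x. gen_powr f g V \<rho> x \<le> - w x"
    and "\<forall>x \<epsilon>. 0 < \<epsilon> \<and> \<epsilon> \<le> 1 \<longrightarrow> V (\<epsilon> *\<^sub>R x) \<le> V x"
    and "\<forall>u>0. growth_sup f g V w \<rho> \<delta> u < \<infinity>"
    and "\<phi> \<in> {0<..} \<rightarrow> {0<..}" and "strict_mono_on {0<..} \<phi>"
    and "continuous_on {0<..} \<phi>" and "filterlim \<phi> at_top at_top"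
    and "\<forall>u\<ge>1. scheme_sup f g V w \<rho> \<delta> u \<le> ennreal (\<phi> u)"
    and "0 < \<theta>" and "\<theta> < 1 / 2"
    and "0 < \<Delta>s" and "\<Delta>s < 1" and "K > 0"
    and "K * \<Delta>s powr (- \<theta>) \<ge> \<phi> (max (norm x0) 1)"
  shows "\<exists>\<Delta>ss. 0 < \<Delta>ss \<and> \<Delta>ss \<le> \<Delta>s \<and>
    (\<forall>\<Delta>. 0 < \<Delta> \<and> \<Delta> \<le> \<Delta>ss \<longrightarrow>
      (AE \<omega> in M.
         limsup (\<lambda>k. ereal (V (truncated_EM f g B \<phi> K \<theta> x0 \<Delta> k \<omega>) powr \<rho>)) < \<infinity> \<and>
         (\<lambda>k. infdist (truncated_EM f g B \<phi> K \<theta> x0 \<Delta> k \<omega>) (Ker w)) \<longlonglongrightarrow> 0) \<and>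
      ((\<forall>x. w x = 0 \<longleftrightarrow> x = 0) \<longrightarrow>
        (AE \<omega> in M. (\<lambda>k. truncated_EM f g B \<phi> K \<theta> x0 \<Delta> k \<omega>) \<longlonglongrightarrow> 0)))"
proof -
  note V = assms(10) and w_cont = assms(11) and \<rho> = assms(7)
  interpret usual_stochastic_basis M F by fact
  have w: "\<And>x. 0 \<le> w x" and gen: "\<And>x. gen_powr f g V \<rho> x \<le> - w x"
    and V_scale: "\<And>x \<epsilon>. 0 < \<epsilon> \<Longrightarrow> \<epsilon> \<le> 1 \<Longrightarrow> V (\<epsilon> *\<^sub>R x) \<le> V x"
    using assms(12-14) by blast+
  have \<delta>: "0 < \<delta>" proof -
    have "0 < 1 / \<delta>" using assms(9) by linarith
    then show ?thesis by simp
  qed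
  have f_cont: "continuous_on UNIV f" and g_cont: "continuous_on UNIV g"
    using local_lipschitz_continuous_on[OF assms(3), of 0] local_lipschitz_continuous_on[OF assms(5), of 0] by auto
  have V_nn: "\<And>x. 0 \<le> V x" and V0: "V 0 = 0" and V_cont: "continuous_on UNIV V"
    using V by (auto simp: lyapunov_class_def C_inf_def Ker_def numeral_eq_Suc)
  have W_cont: "continuous_on UNIV (\<lambda>x. V x powr \<rho>)"
    using V_nn \<rho> by (intro continuous_on_powr' V_cont continuous_intros) auto
  have w0: "w 0 = 0" using gen[of 0] w[of 0] by (simp add: gen_powr_def)
  obtain c where c: "0 \<le> c" "\<And>\<Delta> \<tau> x. x \<noteq> 0 \<Longrightarrow> 0 < \<Delta> \<Longrightarrow> 0 \<le> \<tau> \<Longrightarrow> \<tau> \<le> 1 \<Longrightarrow>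
      norm (f x) * \<Delta> \<le> \<tau> * (sqrt (Lambda V w \<rho> x) * V x powr \<delta>) \<Longrightarrow>
      (norm (g x))\<^sup>2 * \<Delta> \<le> \<tau> * (Lambda V w \<rho> x * (V x powr \<delta>)\<^sup>2) \<Longrightarrow>
      \<exists>E\<ge>0. (\<integral>\<^sup>+b. ennreal (V (x + \<Delta> *\<^sub>R f x + g x *v b) powr \<rho>) \<partial>gauss (sqrt \<Delta>)) \<le> ennreal E
        \<and> E \<le> V x powr \<rho> - \<Delta> * w x + c * \<tau>\<^sup>2 * w x"
    by (rule one_step[OF V \<delta> \<rho> w gen]) blast
  \<comment> \<open>\<open>S \<Delta>\<^sup>1\<^sup>-\<^sup>2\<^sup>\<theta> \<le> 1\<close> implies both \<open>\<tau> \<le> 1\<close> and \<open>c \<tau>\<^sup>2 \<le> \<Delta>/2\<close>, where \<open>\<tau> = K \<Delta>\<^sup>1\<^sup>-\<^sup>\<theta>\<close> and \<open>\<Delta> \<le> 1\<close>\<close>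
  define S where "S = 2 * c * K\<^sup>2 + K + 1"
  have S: "0 < S" using c(1) \<open>K > 0\<close> by (simp add: S_def add_nonneg_pos)
  define \<Delta>ss where "\<Delta>ss = min \<Delta>s ((1 / S) powr (1 / (1 - 2 * \<theta>)))"
  have main: "AE \<omega> in M.
         limsup (\<lambda>k. ereal (V (truncated_EM f g B \<phi> K \<theta> x0 \<Delta> k \<omega>) powr \<rho>)) < \<infinity> \<and>
         (\<lambda>k. infdist (truncated_EM f g B \<phi> K \<theta> x0 \<Delta> k \<omega>) (Ker w)) \<longlonglongrightarrow> 0"
    if \<Delta>: "0 < \<Delta>" "\<Delta> \<le> \<Delta>ss" for \<Delta>
  proof -
    define \<kappa> where "\<kappa> = K * \<Delta> powr (- \<theta>)"
    define \<tau> where "\<tau> = \<kappa> * \<Delta>"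
    define R where "R = the_inv_into {0<..} \<phi> \<kappa>"
    define Z where "Z = truncated_EM f g B \<phi> K \<theta> x0 \<Delta>"
    define T :: "real^'d \<Rightarrow> real^'d" where "T = trunc_map \<phi> K \<theta> \<Delta>"
    have \<Delta>1: "\<Delta> \<le> 1" using \<Delta>(2) \<open>\<Delta>s < 1\<close> by (simp add: \<Delta>ss_def)
    have \<kappa>: "0 < \<kappa>" using \<open>K > 0\<close> \<Delta> by (simp add: \<kappa>_def)
    have "\<Delta>s powr (- \<theta>) \<le> \<Delta> powr (- \<theta>)"
      using \<Delta> \<open>0 < \<theta>\<close> by (intro powr_mono2') (auto simp: \<Delta>ss_def)
    \<comment> \<open>hence the initial value and the unit ball lie in the truncation ball\<close>
    then have "K * \<Delta>s powr (- \<theta>) \<le> \<kappa>" using \<open>K > 0\<close> by (simp add: \<kappa>_def)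
    then have "\<phi> (max (norm x0) 1) \<le> \<kappa>" using assms(26) by linarith
    then have R: "max (norm x0) 1 \<le> R" "\<phi> R = \<kappa>"
      using the_inv_into_above[OF assms(17,18,19), of "max (norm x0) 1" \<kappa>] by (simp_all add: R_def)
    have T_le: "norm (T x) \<le> R" for x
      using norm_trunc_map_le[of \<phi> K \<Delta> \<theta> x] R(1) by (simp add: T_def R_def \<kappa>_def)
    have V_T: "V (T x) \<le> V x" for x
    proof -
      obtain \<epsilon> where "0 < \<epsilon>" "\<epsilon> \<le> 1" "T x = \<epsilon> *\<^sub>R x"
        using trunc_map_scales[of \<phi> K \<Delta> \<theta> x] R(1) unfolding T_def R_def \<kappa>_def by (metis less_le_trans max.cobounded2 zero_less_one)
      then show ?thesis using V_scale by simp
    qed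
    have Z_le: "norm (Z k \<omega>) \<le> R" for k \<omega>
      using R(1) T_le by (cases k) (auto simp: Z_def Let_def simp flip: T_def)
    have S\<Delta>: "S * \<Delta> powr (1 - 2 * \<theta>) \<le> 1"
    proof -
      have "\<Delta> powr (1 - 2 * \<theta>) \<le> ((1 / S) powr (1 / (1 - 2 * \<theta>))) powr (1 - 2 * \<theta>)"
        using \<Delta> \<open>\<theta> < 1 / 2\<close> by (intro powr_mono2) (auto simp: \<Delta>ss_def)
      also have "\<dots> = 1 / S" using S \<open>\<theta> < 1 / 2\<close> by (simp add: powr_powr)
      finally show ?thesis using S by (simp add: field_simps)
    qed
    have \<tau>_eq: "\<tau> = K * \<Delta> powr (1 - \<theta>)"
      using \<Delta> by (simp add: \<tau>_def \<kappa>_def powr_diff powr_minus divide_inverse)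
    have \<tau>: "0 \<le> \<tau>" "\<tau> \<le> 1"
    proof -
      have "\<tau> \<le> S * \<Delta> powr (1 - 2 * \<theta>)"
        unfolding \<tau>_eq using \<Delta> \<Delta>1 c(1) \<open>K > 0\<close> \<open>0 < \<theta>\<close>
        by (intro mult_mono powr_mono') (auto simp: S_def)
      with S\<Delta> show "\<tau> \<le> 1" by linarith
    qed (use \<kappa> \<Delta> in \<open>simp add: \<tau>_def\<close>)
    have c\<tau>: "c * \<tau>\<^sup>2 \<le> \<Delta> / 2"
    proof -
      have "2 * (c * \<tau>\<^sup>2) = 2 * c * K\<^sup>2 * (\<Delta> powr (1 - 2 * \<theta>) * \<Delta>)"
        using \<Delta> by (simp add: \<tau>_eq power_mult_distrib power2_eq_square powr_diff powr_add[symmetric] field_simps)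
      also have "\<dots> \<le> S * (\<Delta> powr (1 - 2 * \<theta>) * \<Delta>)"
        using \<Delta> \<open>K > 0\<close> by (intro mult_right_mono) (auto simp: S_def)
      also have "\<dots> = S * \<Delta> powr (1 - 2 * \<theta>) * \<Delta>" by simp
      also have "\<dots> \<le> 1 * \<Delta>" using S\<Delta> \<Delta> by (intro mult_right_mono) auto
      finally show ?thesis by simp
    qed
    \<comment> \<open>half of the decrease provided by the generator is spent on the error\<close>
    have step: "(\<integral>\<^sup>+b. ennreal (V (T (x + \<Delta> *\<^sub>R f x + g x *v b)) powr \<rho>) \<partial>gauss (sqrt \<Delta>))
        + ennreal (\<Delta> / 2 * w x) \<le> ennreal (V x powr \<rho>)" if x: "norm x \<le> R" for x
    proof (cases "x = 0")
      case True
      have "T 0 = 0" by (simp add: T_def trunc_map_def)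
      then show ?thesis using True assms(4,6) w0 V0 by simp
    next
      case False
      have "1 \<le> R" using R(1) by simp
      then have sup: "scheme_sup f g V w \<rho> \<delta> R \<le> ennreal \<kappa>" using assms(20) R(2) by auto
      note bounds = scheme_sup_bounds[where f=f and g=g, OF sup less_imp_le[OF \<kappa>] False x w]
      have "norm (f x) * \<Delta> \<le> \<tau> * (sqrt (Lambda V w \<rho> x) * V x powr \<delta>)"
        "(norm (g x))\<^sup>2 * \<Delta> \<le> \<tau> * (Lambda V w \<rho> x * (V x powr \<delta>)\<^sup>2)"
        using mult_right_mono[OF bounds(1), of \<Delta>] mult_right_mono[OF bounds(2), of \<Delta>] \<Delta>
        by (simp_all add: \<tau>_def mult_ac)
      from c(2)[OF False \<Delta>(1) \<tau> this] obtain E where E: "0 \<le> E"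
        "(\<integral>\<^sup>+b. ennreal (V (x + \<Delta> *\<^sub>R f x + g x *v b) powr \<rho>) \<partial>gauss (sqrt \<Delta>)) \<le> ennreal E"
        "E \<le> V x powr \<rho> - \<Delta> * w x + c * \<tau>\<^sup>2 * w x" by blast
      have "(\<integral>\<^sup>+b. ennreal (V (T (x + \<Delta> *\<^sub>R f x + g x *v b)) powr \<rho>) \<partial>gauss (sqrt \<Delta>))
          \<le> (\<integral>\<^sup>+b. ennreal (V (x + \<Delta> *\<^sub>R f x + g x *v b) powr \<rho>) \<partial>gauss (sqrt \<Delta>))"
        using V_nn \<rho> V_T by (intro nn_integral_mono ennreal_leI powr_mono2) auto
      also note E(2)
      finally have "(\<integral>\<^sup>+b. ennreal (V (T (x + \<Delta> *\<^sub>R f x + g x *v b)) powr \<rho>) \<partial>gauss (sqrt \<Delta>))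
        + ennreal (\<Delta> / 2 * w x) \<le> ennreal E + ennreal (\<Delta> / 2 * w x)"
        by (rule add_right_mono)
      also have "\<dots> = ennreal (E + \<Delta> / 2 * w x)" using E(1) w \<Delta> by simp
      also have "\<dots> \<le> ennreal (V x powr \<rho>)"
      proof (rule ennreal_leI)
        have "c * \<tau>\<^sup>2 * w x \<le> \<Delta> / 2 * w x" by (intro mult_right_mono c\<tau> w)
        with E(3) show "E + \<Delta> / 2 * w x \<le> V x powr \<rho>" by linarith
      qed
      finally show ?thesis .
    qed
    have Z_adapted: "Z k \<in> borel_measurable (F (real k * \<Delta>))" for k
      unfolding Z_def by (rule truncated_EM_adapted[OF assms(1,2) f_cont g_cont \<Delta>(1)])
    have sub: "subalgebra M (F (real k * \<Delta>))" for k using subalg \<Delta> by simp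
    have [measurable]: "Z k \<in> borel_measurable M" for k
      by (rule measurable_from_subalg[OF sub Z_adapted])
    have [measurable]: "(\<lambda>x. V x powr \<rho>) \<in> borel_measurable borel" "w \<in> borel_measurable borel"
      by (intro borel_measurable_continuous_onI W_cont w_cont)+
    define \<Phi> where "\<Phi> z = ennreal (V (T (fst z + \<Delta> *\<^sub>R f (fst z) + g (fst z) *v snd z)) powr \<rho>)"
      for z :: "(real^'d) \<times> (real^'m)"
    have \<Phi>: "\<Phi> \<in> borel_measurable (borel \<Otimes>\<^sub>M borel)"
      unfolding \<Phi>_def T_def
      by (intro measurable_compose[OF _ measurable_ennreal]
          measurable_compose[OF euler_step_measurable[OF f_cont g_cont]]) measurable
    have "AE \<omega> in M. (\<lambda>k. \<Delta> / 2 * w (Z k \<omega>)) \<longlonglongrightarrow> 0"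
    proof (rule AE_tendsto_0_of_drift[where a="\<lambda>k \<omega>. ennreal (V (Z k \<omega>) powr \<rho>)"])
      fix k
      let ?s = "real k * \<Delta>" and ?t = "real (Suc k) * \<Delta>"
      have st: "0 \<le> ?s" "?s < ?t" and ts: "?t - ?s = \<Delta>" using \<Delta> by (auto simp: algebra_simps)
      have "(\<integral>\<^sup>+\<omega>. ennreal (V (Z (Suc k) \<omega>) powr \<rho>) \<partial>M) = (\<integral>\<^sup>+\<omega>. \<Phi> (Z k \<omega>, B ?t \<omega> - B ?s \<omega>) \<partial>M)"
        by (simp add: Z_def \<Phi>_def T_def Let_def)
      also have "\<dots> = (\<integral>\<^sup>+\<omega>. \<integral>\<^sup>+b. \<Phi> (Z k \<omega>, b) \<partial>gauss (sqrt \<Delta>) \<partial>M)"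
        using nn_integral_brownian_increment[OF prob_space_axioms assms(2) st sub Z_adapted \<Phi>] by (simp only: ts)
      finally have "(\<integral>\<^sup>+\<omega>. ennreal (V (Z (Suc k) \<omega>) powr \<rho>) \<partial>M) + (\<integral>\<^sup>+\<omega>. ennreal (\<Delta> / 2 * w (Z k \<omega>)) \<partial>M)
        = (\<integral>\<^sup>+\<omega>. (\<integral>\<^sup>+b. \<Phi> (Z k \<omega>, b) \<partial>gauss (sqrt \<Delta>)) + ennreal (\<Delta> / 2 * w (Z k \<omega>)) \<partial>M)"
      proof (subst nn_integral_add)
        interpret G: prob_space "gauss (sqrt \<Delta>) :: (real^'m) measure" by (rule prob_space_gauss) (use \<Delta> in simp)
        have "\<Phi> \<in> borel_measurable (borel \<Otimes>\<^sub>M (gauss (sqrt \<Delta>)))"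
          using \<Phi> by (simp cong: measurable_cong_sets add: measurable_cong_sets[OF sets_pair_measure_cong[OF refl sets_gauss] refl])
        then have "(\<lambda>x. \<integral>\<^sup>+b. \<Phi> (x, b) \<partial>gauss (sqrt \<Delta>)) \<in> borel_measurable borel"
          by (rule G.borel_measurable_nn_integral_fst)
        then show "(\<lambda>\<omega>. \<integral>\<^sup>+b. \<Phi> (Z k \<omega>, b) \<partial>gauss (sqrt \<Delta>)) \<in> borel_measurable M"
          by (rule measurable_compose[rotated]) simp
      qed simp_all
      also have "\<dots> \<le> (\<integral>\<^sup>+\<omega>. ennreal (V (Z k \<omega>) powr \<rho>) \<partial>M)"
        by (rule nn_integral_mono) (simp only: \<Phi>_def fst_conv snd_conv step[OF Z_le])
      finally show "(\<integral>\<^sup>+\<omega>. ennreal (V (Z (Suc k) \<omega>) powr \<rho>) \<partial>M) + (\<integral>\<^sup>+\<omega>. ennreal (\<Delta> / 2 * w (Z k \<omega>)) \<partial>M)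
          \<le> (\<integral>\<^sup>+\<omega>. ennreal (V (Z k \<omega>) powr \<rho>) \<partial>M)" .
    next
      show "(\<integral>\<^sup>+\<omega>. ennreal (V (Z 0 \<omega>) powr \<rho>) \<partial>M) < \<infinity>"
        by (simp add: Z_def emeasure_space_1 ennreal_mult_less_top)
    qed (use \<Delta> w in \<open>auto intro: prob_space_axioms\<close>)
    then show ?thesis
      unfolding Z_def[symmetric]
    proof eventually_elim
      case (elim \<omega>)
      have "(\<lambda>k. 2 / \<Delta> * (\<Delta> / 2 * w (Z k \<omega>))) \<longlonglongrightarrow> 2 / \<Delta> * 0" by (intro tendsto_mult_left elim)
      then have "(\<lambda>k. w (Z k \<omega>)) \<longlonglongrightarrow> 0" using \<Delta> by simp
      from infdist_zero_set_tendsto[OF w_cont w Z_le this]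
      have "(\<lambda>k. infdist (Z k \<omega>) (Ker w)) \<longlonglongrightarrow> 0" by (simp add: Ker_def)
      moreover have "limsup (\<lambda>k. ereal (V (Z k \<omega>) powr \<rho>)) < \<infinity>"
      proof -
        have "cball (0 :: real^'d) R \<noteq> {}" using R(1) by auto
        from continuous_attains_sup[OF compact_cball this continuous_on_subset[OF W_cont subset_UNIV]]
        obtain y where y: "\<And>x. x \<in> cball 0 R \<Longrightarrow> V x powr \<rho> \<le> V y powr \<rho>" by blast
        have "limsup (\<lambda>k. ereal (V (Z k \<omega>) powr \<rho>)) \<le> ereal (V y powr \<rho>)"
          by (intro Limsup_bounded always_eventually allI) (simp add: y Z_le)
        then show ?thesis by (rule le_less_trans) simp
      qed
      ultimately show ?case by blast
    qed
  qed
  show ?thesis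
  proof (intro exI[of _ \<Delta>ss] conjI allI impI)
    show "0 < \<Delta>ss" using S \<open>0 < \<Delta>s\<close> by (simp add: \<Delta>ss_def)
    show "\<Delta>ss \<le> \<Delta>s" by (simp add: \<Delta>ss_def)
    fix \<Delta> assume \<Delta>: "0 < \<Delta> \<and> \<Delta> \<le> \<Delta>ss"
    then show m: "AE \<omega> in M.
         limsup (\<lambda>k. ereal (V (truncated_EM f g B \<phi> K \<theta> x0 \<Delta> k \<omega>) powr \<rho>)) < \<infinity> \<and>
         (\<lambda>k. infdist (truncated_EM f g B \<phi> K \<theta> x0 \<Delta> k \<omega>) (Ker w)) \<longlonglongrightarrow> 0"
      using main by blast
    assume "\<forall>x. w x = 0 \<longleftrightarrow> x = 0"
    then have "Ker w = {0}" by (auto simp: Ker_def)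
    then show "AE \<omega> in M. (\<lambda>k. truncated_EM f g B \<phi> K \<theta> x0 \<Delta> k \<omega>) \<longlonglongrightarrow> 0"
      using m by (auto elim!: eventually_mono simp: tendsto_norm_zero_iff)
  qed
qed

end
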